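(* Let $k\ge1$ be a fixed integer. There are constants $C=C(k)$ and $D=D(k)$, depending only on $k$, such that for every integer $m\ge1$ and every integer $r\ge0$, the number of equivalence classes of admissible words with defect $r$ is at most $$F_{k,m}(Cm)^{Dr},\qquad\text{where } F_{k,m}=\frac1{km+1}\binom{(k+1)m}{m}.$$
   Context: Put $L=km$. The sign pattern is the sequence of $2L$ signs consisting of $m$ repetitions of the block of $k$ plus signs followed by $k$ minus signs; positions $s=1,\dots,2L$ are called occurrences, and $s$ is a plus or minus occurrence according to its sign. A (closed) word is a sequence of vertex labels $\mathbf i=(i_0,i_1,\dots,i_{2L})$ with $i_{2L}=i_0$. The ordered variable-edge at occurrence $s$ is $e_s(\mathbf i)=(i_{s-1},i_s)$ if $s$ is a plus occurrence and $e_s(\mathbf i)=(i_s,i_{s-1})$ if $s$ is a minus occurrence. Let $v(\mathbf i)=\#\{i_0,\dots,i_{2L-1}\}$ and let $q(\mathbf i)$ be the number of distinct ordered pairs among $e_1(\mathbf i),\dots,e_{2L}(\mathbf i)$. Two words are equivalent if one is obtained from the other by relabeling the visited vertices (so an equivalence class is the same as a partition of the corner set $\{0,\dots,2L-1\}$). A word is admissible if every ordered variable-edge that appears in it appears for at least two occurrences $s$. The defect of an admissible word is $d(\mathbf i)=(L+1-v(\mathbf i))+(L-q(\mathbf i))$. *)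

theory Defs
  imports Complex_Main
begin

text \<open>
  Throughout, \<open>L = k * m\<close>. Vertex labels are natural numbers; since there are infinitely many of
  them, every equivalence class of words (every partition of the corner set) is represented.
\<close>

text \<open>\<open>True\<close> stands for plus and \<open>False\<close> for minus.\<close>

definition sign_pattern :: "nat \<Rightarrow> nat \<Rightarrow> bool list" where
  "sign_pattern k m = concat (replicate m (replicate k True @ replicate k False))"

definition occurrences :: "nat \<Rightarrow> nat \<Rightarrow> nat set" where
  "occurrences k m = {1..2 * (k * m)}"

text \<open>Occurrences are numbered from 1, list positions from 0.\<close>

definition plus_occurrence :: "nat \<Rightarrow> nat \<Rightarrow> nat \<Rightarrow> bool" where
  "plus_occurrence k m s \<longleftrightarrow> sign_pattern k m ! (s - 1)"

definition closed_word :: "nat \<Rightarrow> nat \<Rightarrow> nat list \<Rightarrow> bool" where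
  "closed_word k m w \<longleftrightarrow> length w = 2 * (k * m) + 1 \<and> w ! (2 * (k * m)) = w ! 0"

definition var_edge :: "nat \<Rightarrow> nat \<Rightarrow> nat list \<Rightarrow> nat \<Rightarrow> nat \<times> nat" where
  "var_edge k m w s =
     (if plus_occurrence k m s then (w ! (s - 1), w ! s) else (w ! s, w ! (s - 1)))"

definition num_vertices :: "nat \<Rightarrow> nat \<Rightarrow> nat list \<Rightarrow> nat" where
  "num_vertices k m w = card ((\<lambda>j. w ! j) ` {..<2 * (k * m)})"

definition num_edges :: "nat \<Rightarrow> nat \<Rightarrow> nat list \<Rightarrow> nat" where
  "num_edges k m w = card (var_edge k m w ` occurrences k m)"

definition admissible :: "nat \<Rightarrow> nat \<Rightarrow> nat list \<Rightarrow> bool" where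
  "admissible k m w \<longleftrightarrow> closed_word k m w \<and>
     (\<forall>e \<in> var_edge k m w ` occurrences k m. card {s \<in> occurrences k m. var_edge k m w s = e} \<ge> 2)"

text \<open>Integer-valued, so that neither difference is truncated.\<close>

definition defect :: "nat \<Rightarrow> nat \<Rightarrow> nat list \<Rightarrow> int" where
  "defect k m w = (int (k * m) + 1 - int (num_vertices k m w)) + (int (k * m) - int (num_edges k m w))"

text \<open>Only the visited vertices are relabelled, so \<open>f\<close> need not be injective elsewhere.\<close>

definition relabel_rel :: "(nat list \<times> nat list) set" where
  "relabel_rel = {(w, w'). \<exists>f. inj_on f (set w) \<and> w' = map f w}"

lemma equiv_relabel_rel: "equiv UNIV relabel_rel"
proof (rule equivI)
  show "relabel_rel \<subseteq> UNIV \<times> UNIV" by simp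
  show "refl relabel_rel"
    by (auto simp: refl_on_def relabel_rel_def intro!: exI[of _ id])
  show "sym relabel_rel"
  proof (rule symI)
    fix w w' assume "(w, w') \<in> relabel_rel"
    then obtain f where f: "inj_on f (set w)" "w' = map f w"
      by (auto simp: relabel_rel_def)
    have "map (inv_into (set w) f) w' = w"
      using f by (auto intro: map_idI)
    moreover have "inj_on (inv_into (set w) f) (set w')"
      using f by (simp add: inj_on_inv_into)
    ultimately show "(w', w) \<in> relabel_rel"
      unfolding relabel_rel_def by (auto intro!: exI[of _ "inv_into (set w) f"])
  qed
  show "trans relabel_rel"
  proof (rule transI)
    fix u v w assume "(u, v) \<in> relabel_rel" "(v, w) \<in> relabel_rel"
    then obtain f g where "inj_on f (set u)" "v = map f u" "inj_on g (set v)" "w = map g v"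
      by (auto simp: relabel_rel_def)
    then have "inj_on (g \<circ> f) (set u)" "w = map (g \<circ> f) u"
      by (auto intro: comp_inj_on)
    then show "(u, w) \<in> relabel_rel"
      unfolding relabel_rel_def by blast
  qed
qed

text \<open>
  Admissibility and defect are invariant under relabelling, so the quotient consists of full
  relabelling classes.
\<close>

definition admissible_classes :: "nat \<Rightarrow> nat \<Rightarrow> nat \<Rightarrow> nat list set set" where
  "admissible_classes k m r = {w. admissible k m w \<and> defect k m w = int r} // relabel_rel"

definition fuss_catalan :: "nat \<Rightarrow> nat \<Rightarrow> real" where
  "fuss_catalan k m = 1 / real (k * m + 1) * real (((k + 1) * m) choose m)"

end

theory Submission
  imports Defs "HOL-Library.FuncSet" "HOL-Computational_Algebra.Formal_Power_Series" "HOL-Analysis.L2_Norm"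
begin

text \<open>
  Why the bound holds. A word of defect \<open>0\<close> is a walk around a plane tree that uses every edge once
  with each sign, so its class is a noncrossing matching of plus with minus occurrences, and
  there are exactly \<open>F k m\<close> of these (\<open>nc_count_eq_fuss_catalan\<close>). In general
  \<open>q \<le> L\<close>, hence defect \<open>r\<close> forces at least \<open>L + 1 - r\<close> vertices, and the proof shows that such
  a word is a noncrossing matching up to \<open>O(r)\<close> pieces of information with \<open>O(m)\<close> values each.

  As long as some vertex other than the base point is visited exactly once, the walk enters and
  leaves it through the same edge, with opposite signs, and the two steps can be deleted (\<open>peel\<close>).
  Peeling loses nothing but a sequence of push/cancel decisions: the class of the word is
  determined by these and by the class of the remaining reduced walk (\<open>peel_determines\<close>).
  The difference between the number of vertices and half the length is unchanged, so almost all
  vertices of the reduced walk are visited exactly twice. Call the others, the base point, and the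
  vertices at which the walk turns back, special. There are at most \<open>8 r\<close> visits to special
  vertices (\<open>special_bound\<close>). They cut the reduced walk into segments, and because every edge is
  used at least twice, each segment is run through a second time, in the same or in the opposite
  direction (\<open>seg_mate\<close>). Hence a reduced walk is determined by a combinatorial shape, for
  which there are \<open>m\<close> to the power \<open>O(r)\<close> choices, and by one sign word \<open>\<beta>\<close> for each class of segments.

  It remains to sum, over all choices of the words \<open>\<beta>\<close>, the number of ways to reduce the sign
  pattern to the concatenation of the (possibly reversed) words \<open>\<beta>\<close>. Cutting the pattern where
  the segments end, this is a sum of products of numbers \<open>A(u, \<beta>)\<close>: the number of ways to reduce an
  interval \<open>u\<close> of the pattern to \<open>\<beta>\<close>. Since each \<open>\<beta>\<close> occurs at least twice, the Cauchy-Schwarz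
  inequality (\<open>sum_prod_classes_le\<close>) bounds the sum by the product of the norms
  \<open>sqrt (\<Sum>\<beta>. A(u, \<beta>)\<^sup>2)\<close>. The square of such a norm counts the full noncrossing matchings of \<open>u\<close> preceded
  by its reversed negative (\<open>sq_norm_eq\<close>); for an interval of the pattern this is essentially a pattern of
  twice the length, so the norm is at most \<open>\<rho>\<close> to the number of blocks, up to a constant factor, where
  \<open>\<rho> = (k+1)^(k+1) / k^k\<close> is the growth rate of \<open>F k m\<close>. The product over all intervals is therefore
  \<open>\<rho>^m\<close> times a constant to the power \<open>O(r)\<close>, and \<open>\<rho>^m\<close> exceeds \<open>F k m\<close> by a factor
  polynomial in \<open>m\<close> only. For \<open>r \<ge> 1\<close> that factor is absorbed into \<open>(C m)^(D r)\<close>; for \<open>r = 0\<close> the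
  reduced walk is empty and the count is exact.
\<close>

section \<open>Reductions of sign words\<close>

text \<open>
  Read \<open>w\<close> from its last letter to its first and keep a stack of signs: each letter is either pushed
  or cancels an opposite sign on top of the stack. The number of ways to end with the stack \<open>\<alpha>\<close>
  (top first) is the number of noncrossing partial matchings of opposite signs in \<open>w\<close> whose unmatched
  letters are enclosed by no matched pair and spell \<open>\<alpha>\<close>. These are the coordinates, in the free Fock
  space over two letters, of the vector that a word in a circular element and its adjoint makes out of
  the vacuum.
\<close>

fun red_count :: "bool list \<Rightarrow> bool list \<Rightarrow> nat" where
  "red_count [] \<alpha> = (if \<alpha> = [] then 1 else 0)"
| "red_count (x # w) \<alpha> =
     (if \<alpha> \<noteq> [] \<and> hd \<alpha> = x then red_count w (tl \<alpha>) else 0) + red_count w ((\<not> x) # \<alpha>)"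

text \<open>
  The computations counted by \<open>red_count\<close>, each recorded by one Boolean per letter: \<open>True\<close> for a push,
  \<open>False\<close> for a cancellation.
\<close>

fun reductions :: "bool list \<Rightarrow> bool list \<Rightarrow> bool list set" where
  "reductions [] \<alpha> = (if \<alpha> = [] then {[]} else {})"
| "reductions (x # w) \<alpha> =
     (#) True ` (if \<alpha> \<noteq> [] \<and> hd \<alpha> = x then reductions w (tl \<alpha>) else {})
     \<union> (#) False ` reductions w ((\<not> x) # \<alpha>)"

lemma finite_reductions: "finite (reductions w \<alpha>)"
  by (induction w \<alpha> rule: reductions.induct) auto

lemma card_reductions: "card (reductions w \<alpha>) = red_count w \<alpha>"
proof (induction w arbitrary: \<alpha>)
  case (Cons x w)
  have "card (reductions (x # w) \<alpha>) =
      card ((#) True ` (if \<alpha> \<noteq> [] \<and> hd \<alpha> = x then reductions w (tl \<alpha>) else {}))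
      + card ((#) False ` reductions w ((\<not> x) # \<alpha>))"
    unfolding reductions.simps by (rule card_Un_disjoint) (auto simp: finite_reductions)
  then show ?case
    by (simp add: card_image Cons.IH)
qed simp

text \<open>
  No matched pair encloses the unmatched letter \<open>y\<close>, so the letters before and after it reduce
  independently.
\<close>

lemma red_count_split:
  "red_count w (\<beta> @ y # \<alpha>) =
     (\<Sum>i<length w. if w ! i = y then red_count (take i w) \<beta> * red_count (drop (Suc i) w) \<alpha> else 0)"
proof (induction w arbitrary: \<beta>)
  case (Cons x w)
  have pop: "red_count w ((\<not> x) # \<beta> @ y # \<alpha>) =
     (\<Sum>i<length w. if w ! i = y then red_count (take i w) ((\<not> x) # \<beta>) * red_count (drop (Suc i) w) \<alpha> else 0)"
    using Cons.IH[of "(\<not> x) # \<beta>"] by simp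
  show ?case
  proof (cases \<beta>)
    case Nil
    show ?thesis
      unfolding Nil using pop[unfolded Nil]
      by (cases x; cases y; simp add: sum.lessThan_Suc_shift del: sum.lessThan_Suc cong: if_cong)
  next
    case (Cons b \<beta>')
    show ?thesis
      unfolding Cons using pop[unfolded Cons] Cons.IH[of \<beta>']
      by (cases x; cases y; cases b)
         (auto simp: sum.lessThan_Suc_shift sum.distrib[symmetric] algebra_simps
               simp del: sum.lessThan_Suc cong: if_cong intro!: sum.cong)
  qed
qed simp

text \<open>
  The last letter is read first and lies at the bottom of the stack: it either survives, or is cancelled by
  the letter at some position \<open>i\<close>, and then the letters between the two reduce to nothing.
\<close>

lemma red_count_snoc:
  "red_count (w @ [x]) \<alpha> =
     (if \<alpha> \<noteq> [] \<and> last \<alpha> = x then red_count w (butlast \<alpha>) else 0) +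
     (\<Sum>i<length w. if w ! i = (\<not> x) then red_count (take i w) \<alpha> * red_count (drop (Suc i) w) [] else 0)"
proof (induction w arbitrary: \<alpha>)
  case Nil
  then show ?case
    by (cases \<alpha>) auto
next
  case (Cons y w)
  show ?case
  proof (cases \<alpha>)
    case Nil
    show ?thesis
      unfolding Nil using Cons.IH[of "[\<not> y]"]
      by (cases x; cases y; simp add: sum.lessThan_Suc_shift del: sum.lessThan_Suc cong: if_cong)
  next
    case (Cons a \<alpha>')
    have "red_count (w @ [x]) (a # \<alpha>') = red_count (w @ [x]) (a # \<alpha>')" ..
    show ?thesis
      unfolding Cons using Cons.IH[of "(\<not> y) # a # \<alpha>'"] Cons.IH[of \<alpha>']
      by (cases x; cases y; cases a)
         (auto simp: sum.lessThan_Suc_shift sum.distrib[symmetric] algebra_simps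
               simp del: sum.lessThan_Suc cong: if_cong intro!: sum.cong)
  qed
qed

text \<open>
  Noncrossing matchings live on a circle: both sides sum over the partner of \<open>x\<close>.
\<close>

lemma red_count_rotate: "red_count (w @ [x]) [] = red_count (x # w) []"
  using red_count_split[of w "[]" "\<not> x" "[]"] by (simp add: red_count_snoc)

lemma red_count_frame: "red_count w \<alpha> \<le> red_count (w @ [x]) (\<alpha> @ [x])"
  by (simp add: red_count_snoc)

lemma red_count_eq_0: "length \<alpha> > length w \<Longrightarrow> red_count w \<alpha> = 0"
  by (induction w arbitrary: \<alpha>) auto

lemma red_count_balanced:
  "red_count w \<alpha> \<noteq> 0 \<Longrightarrow>
     int (count_list w True) - int (count_list w False) =
     int (count_list \<alpha> True) - int (count_list \<alpha> False)"
proof (induction w arbitrary: \<alpha>)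
  case (Cons x w)
  then consider "\<alpha> \<noteq> []" "hd \<alpha> = x" "red_count w (tl \<alpha>) \<noteq> 0" | "red_count w ((\<not> x) # \<alpha>) \<noteq> 0"
    by (auto split: if_splits)
  then show ?case
  proof cases
    case 1
    then show ?thesis using Cons.IH[of "tl \<alpha>"] by (cases \<alpha>) auto
  next
    case 2
    then show ?thesis using Cons.IH[of "(\<not> x) # \<alpha>"] by (cases x) auto
  qed
qed (auto split: if_splits)

definition words_upto :: "nat \<Rightarrow> bool list set" where
  "words_upto N = {\<alpha>. length \<alpha> \<le> N}"

lemma finite_words_upto: "finite (words_upto N)"
  unfolding words_upto_def using finite_lists_length_le[of "UNIV :: bool set" N] by simp

lemma sum_hd_words_upto:
  fixes g :: "bool list \<Rightarrow> nat"
  assumes "\<And>\<beta>. length \<beta> \<ge> N \<Longrightarrow> g (x # \<beta>) = 0"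
  shows "(\<Sum>\<alpha>\<in>words_upto N. (if \<alpha> \<noteq> [] \<and> hd \<alpha> = x then f (tl \<alpha>) else 0) * g \<alpha>) =
         (\<Sum>\<beta>\<in>words_upto N. f \<beta> * g (x # \<beta>))"
proof -
  have "(\<Sum>\<beta>\<in>words_upto N. f \<beta> * g (x # \<beta>)) = (\<Sum>\<beta>\<in>{\<beta>. length \<beta> < N}. f \<beta> * g (x # \<beta>))"
    by (rule sum.mono_neutral_right) (auto simp: finite_words_upto, auto simp: words_upto_def assms)
  also have "\<dots> = (\<Sum>\<alpha>\<in>(#) x ` {\<beta>. length \<beta> < N}. f (tl \<alpha>) * g \<alpha>)"
    by (subst sum.reindex) auto
  also have "\<dots> = (\<Sum>\<alpha>\<in>words_upto N. (if \<alpha> \<noteq> [] \<and> hd \<alpha> = x then f (tl \<alpha>) else 0) * g \<alpha>)"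
  proof (rule sum.mono_neutral_cong_left)
    show "\<forall>i\<in>words_upto N - (#) x ` {\<beta>. length \<beta> < N}. (if i \<noteq> [] \<and> hd i = x then f (tl i) else 0) * g i = 0"
    proof
      fix i assume "i \<in> words_upto N - (#) x ` {\<beta>. length \<beta> < N}"
      then show "(if i \<noteq> [] \<and> hd i = x then f (tl i) else 0) * g i = 0"
        by (cases i) (auto simp: words_upto_def)
    qed
  qed (auto simp: finite_words_upto, auto simp: words_upto_def)
  finally show ?thesis ..
qed

definition flip_rev :: "bool list \<Rightarrow> bool list" where
  "flip_rev w = rev (map Not w)"

lemma flip_rev_flip_rev [simp]: "flip_rev (flip_rev w) = w"
  by (simp add: flip_rev_def rev_map comp_def)

lemma length_flip_rev [simp]: "length (flip_rev w) = length w"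
  by (simp add: flip_rev_def)

text \<open>
  As an operator, reading the letter \<open>x\<close> is a creation of \<open>x\<close> plus an annihilation of \<open>\<not> x\<close>, so its adjoint is the
  reading of \<open>\<not> x\<close>. The letters of \<open>w\<close> are moved to the other side of the inner product one by one.
\<close>

lemma red_count_adjoint:
  assumes "length w + length u \<le> N"
  shows "(\<Sum>\<alpha>\<in>words_upto N. red_count w \<alpha> * red_count u \<alpha>) = red_count (flip_rev w @ u) []"
  using assms
proof (induction w arbitrary: u)
  case Nil
  have "(\<Sum>\<alpha>\<in>words_upto N. red_count [] \<alpha> * red_count u \<alpha>) =
        (\<Sum>\<alpha>\<in>{[]}. red_count [] \<alpha> * red_count u \<alpha>)"
    by (rule sum.mono_neutral_right) (auto simp: finite_words_upto, auto simp: words_upto_def)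
  then show ?case
    by (simp add: flip_rev_def)
next
  case (Cons x w)
  have 1: "(\<Sum>\<alpha>\<in>words_upto N. (if \<alpha> \<noteq> [] \<and> hd \<alpha> = x then red_count w (tl \<alpha>) else 0) * red_count u \<alpha>) =
        (\<Sum>\<alpha>\<in>words_upto N. red_count w \<alpha> * red_count u (x # \<alpha>))"
    using Cons.prems by (intro sum_hd_words_upto) (simp add: red_count_eq_0)
  have 2: "(\<Sum>\<alpha>\<in>words_upto N. (if \<alpha> \<noteq> [] \<and> hd \<alpha> = (\<not> x) then red_count u (tl \<alpha>) else 0) * red_count w \<alpha>) =
        (\<Sum>\<alpha>\<in>words_upto N. red_count u \<alpha> * red_count w ((\<not> x) # \<alpha>))"
    using Cons.prems by (intro sum_hd_words_upto) (simp add: red_count_eq_0)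
  have "(\<Sum>\<alpha>\<in>words_upto N. red_count (x # w) \<alpha> * red_count u \<alpha>) =
        (\<Sum>\<alpha>\<in>words_upto N. red_count w \<alpha> * red_count u (x # \<alpha>)) +
        (\<Sum>\<alpha>\<in>words_upto N. red_count u \<alpha> * red_count w ((\<not> x) # \<alpha>))"
    unfolding 1[symmetric] by (simp add: sum.distrib[symmetric] algebra_simps)
  also have "\<dots> = (\<Sum>\<alpha>\<in>words_upto N. red_count w \<alpha> * red_count ((\<not> x) # u) \<alpha>)"
    unfolding 2[symmetric] by (simp add: sum.distrib[symmetric] algebra_simps)
  also have "\<dots> = red_count (flip_rev w @ (\<not> x) # u) []"
    using Cons.prems by (intro Cons.IH) simp
  finally show ?case by (simp add: flip_rev_def)
qed

definition sq_norm :: "bool list \<Rightarrow> nat" where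
  "sq_norm w = (\<Sum>\<alpha>\<in>words_upto (length w). (red_count w \<alpha>)\<^sup>2)"

lemma sq_norm_words_upto:
  assumes "length w \<le> N"
  shows "(\<Sum>\<alpha>\<in>words_upto N. (red_count w \<alpha>)\<^sup>2) = sq_norm w"
  unfolding sq_norm_def using assms
  by (intro sum.mono_neutral_right) (auto simp: finite_words_upto, auto simp: words_upto_def red_count_eq_0)

lemma sq_norm_eq: "sq_norm w = red_count (flip_rev w @ w) []"
  using red_count_adjoint[of w w "2 * length w"] sq_norm_words_upto[of w "2 * length w"]
  by (simp add: power2_eq_square)

text \<open>
  A new letter can always be left unmatched, at either end of the word.
\<close>

lemma sq_norm_Cons: "sq_norm w \<le> sq_norm (x # w)"
proof -
  have "sq_norm w \<le> (\<Sum>\<alpha>\<in>words_upto (length w). (red_count (x # w) (x # \<alpha>))\<^sup>2)"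
    unfolding sq_norm_def by (intro sum_mono power_mono) auto
  also have "\<dots> = (\<Sum>\<alpha>\<in>(#) x ` words_upto (length w). (red_count (x # w) \<alpha>)\<^sup>2)"
    by (subst sum.reindex) auto
  also have "\<dots> \<le> sq_norm (x # w)"
    unfolding sq_norm_def by (intro sum_mono2) (auto simp: finite_words_upto, auto simp: words_upto_def)
  finally show ?thesis .
qed

lemma sq_norm_snoc: "sq_norm w \<le> sq_norm (w @ [x])"
proof -
  have "sq_norm w \<le> (\<Sum>\<alpha>\<in>words_upto (length w). (red_count (w @ [x]) (\<alpha> @ [x]))\<^sup>2)"
    unfolding sq_norm_def by (intro sum_mono power_mono red_count_frame) auto
  also have "\<dots> = (\<Sum>\<alpha>\<in>(\<lambda>\<alpha>. \<alpha> @ [x]) ` words_upto (length w). (red_count (w @ [x]) \<alpha>)\<^sup>2)"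
    by (subst sum.reindex) (auto simp: inj_on_def)
  also have "\<dots> \<le> sq_norm (w @ [x])"
    unfolding sq_norm_def by (intro sum_mono2) (auto simp: finite_words_upto, auto simp: words_upto_def)
  finally show ?thesis .
qed

lemma sq_norm_sublist: "sq_norm w \<le> sq_norm (u @ w @ v)"
proof -
  have "sq_norm w \<le> sq_norm (w @ v)"
  proof (induction v rule: rev_induct)
    case (snoc x v)
    then show ?case using sq_norm_snoc[of "w @ v" x] by simp
  qed simp
  moreover have "sq_norm (w @ v) \<le> sq_norm (u @ w @ v)"
    by (induction u) (auto intro: order_trans[OF _ sq_norm_Cons])
  ultimately show ?thesis by simp
qed

lemma red_count_le_sqrt: "real (red_count w \<alpha>) \<le> sqrt (real (sq_norm w))"
proof (cases "length \<alpha> \<le> length w")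
  case True
  then have "(red_count w \<alpha>)\<^sup>2 \<le> sq_norm w"
    unfolding sq_norm_def by (intro member_le_sum) (auto simp: finite_words_upto, auto simp: words_upto_def)
  then have "(real (red_count w \<alpha>))\<^sup>2 \<le> real (sq_norm w)"
    by (metis of_nat_le_iff of_nat_power)
  then show ?thesis
    by (rule real_le_rsqrt)
qed (simp add: red_count_eq_0)

section \<open>Noncrossing matchings of the sign pattern\<close>

text \<open>
  The sign pattern continued periodically to all positions, which are counted from \<open>0\<close> here.
\<close>

definition sign_at :: "nat \<Rightarrow> nat \<Rightarrow> bool" where
  "sign_at k i \<longleftrightarrow> i mod (2 * k) < k"

definition sign_interval :: "nat \<Rightarrow> nat \<Rightarrow> nat \<Rightarrow> bool list" where
  "sign_interval k a c = map (sign_at k) [a..<c]"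

lemma length_sign_interval [simp]: "length (sign_interval k a c) = c - a"
  by (simp add: sign_interval_def)

lemma sign_interval_Cons: "a < c \<Longrightarrow> sign_interval k a c = sign_at k a # sign_interval k (Suc a) c"
  by (simp add: sign_interval_def upt_conv_Cons)

lemma sign_interval_snoc: "a \<le> c \<Longrightarrow> sign_interval k a (Suc c) = sign_interval k a c @ [sign_at k c]"
  by (simp add: sign_interval_def)

lemma nth_sign_interval: "i < c - a \<Longrightarrow> sign_interval k a c ! i = sign_at k (a + i)"
  by (simp add: sign_interval_def)

lemma sign_interval_append: "a \<le> b \<Longrightarrow> b \<le> c \<Longrightarrow> sign_interval k a c = sign_interval k a b @ sign_interval k b c"
  by (rule nth_equalityI) (auto simp: nth_sign_interval nth_append add.commute)

lemma take_sign_interval: "i \<le> c - a \<Longrightarrow> take i (sign_interval k a c) = sign_interval k a (a + i)"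
  by (rule nth_equalityI) (auto simp: nth_sign_interval)

lemma drop_sign_interval: "drop i (sign_interval k a c) = sign_interval k (a + i) c"
  by (simp add: sign_interval_def drop_map)

lemma sign_at_periodic [simp]: "sign_at k (i + 2 * k * n) = sign_at k i"
  by (simp add: sign_at_def)

lemma sign_interval_shift: "sign_interval k (a + 2 * k * n) (c + 2 * k * n) = sign_interval k a c"
proof (rule nth_equalityI)
  fix i assume "i < length (sign_interval k (a + 2 * k * n) (c + 2 * k * n))"
  then show "sign_interval k (a + 2 * k * n) (c + 2 * k * n) ! i = sign_interval k a c ! i"
    using sign_at_periodic[of k "a + i" n] by (simp add: nth_sign_interval ac_simps)
qed simp

lemma sign_pattern_eq_interval:
  assumes "k \<ge> 1"
  shows "sign_pattern k m = sign_interval k 0 (2 * k * m)"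
proof (induction m)
  case 0
  then show ?case by (simp add: sign_pattern_def sign_interval_def)
next
  case (Suc m)
  have "sign_interval k 0 (2 * k) = replicate k True @ replicate k False"
  proof (rule nth_equalityI)
    fix i assume "i < length (sign_interval k 0 (2 * k))"
    then show "sign_interval k 0 (2 * k) ! i = (replicate k True @ replicate k False) ! i"
      using assms by (auto simp: nth_sign_interval sign_at_def nth_append)
  qed simp
  moreover have "sign_interval k 0 (2 * k * Suc m) = sign_interval k 0 (2 * k) @ sign_interval k (2 * k) (2 * k * Suc m)"
    by (rule sign_interval_append) auto
  moreover have "sign_interval k (2 * k) (2 * k * Suc m) = sign_interval k 0 (2 * k * m)"
  proof -
    have "sign_interval k (2 * k) (2 * k * Suc m) = sign_interval k (0 + 2 * k * 1) (2 * k * m + 2 * k * 1)"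
      by (simp add: add.commute)
    then show ?thesis by (simp only: sign_interval_shift)
  qed
  ultimately show ?case
    using Suc by (simp add: sign_pattern_def)
qed

text \<open>
  The height of the lattice path that steps up at a plus and down at a minus; it climbs to \<open>k\<close> and
  returns to \<open>0\<close> in each block. Matched positions bound a path segment that ends at the height where it starts.
\<close>

definition height :: "nat \<Rightarrow> nat \<Rightarrow> nat" where
  "height k i = (if i mod (2 * k) \<le> k then i mod (2 * k) else 2 * k - i mod (2 * k))"

lemma height_Suc:
  assumes "k \<ge> 1"
  shows "int (height k (Suc i)) = int (height k i) + (if sign_at k i then 1 else - 1)"
proof -
  have "i mod (2 * k) < 2 * k" using assms by simp
  then show ?thesis
    unfolding height_def sign_at_def mod_Suc by (auto split: if_splits)
qed

lemma sign_interval_height: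
  assumes "k \<ge> 1" "a \<le> c"
  shows "int (count_list (sign_interval k a c) True) - int (count_list (sign_interval k a c) False) =
         int (height k c) - int (height k a)"
  using assms(2)
proof (induction rule: dec_induct)
  case base
  then show ?case by (simp add: sign_interval_def)
next
  case (step n)
  then show ?case
    by (simp add: sign_interval_snoc height_Suc[OF assms(1)])
qed

definition nc_count :: "nat \<Rightarrow> nat \<Rightarrow> nat \<Rightarrow> nat" where
  "nc_count k a c = red_count (sign_interval k a c) []"

lemma nc_count_height:
  assumes "k \<ge> 1" "a \<le> c" "nc_count k a c \<noteq> 0"
  shows "height k a = height k c"
  using sign_interval_height[OF assms(1,2)] red_count_balanced[of "sign_interval k a c" "[]"] assms(3)
  by (simp add: nc_count_def)

lemma nc_count_rec:
  assumes "a < c"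
  shows "nc_count k a c =
    (\<Sum>i<c - Suc a. if sign_at k (Suc a + i) = (\<not> sign_at k a)
       then nc_count k (Suc a) (Suc a + i) * nc_count k (Suc (Suc a + i)) c else 0)"
proof -
  have "nc_count k a c = red_count (sign_interval k (Suc a) c) ([] @ [\<not> sign_at k a])"
    using assms by (simp add: nc_count_def sign_interval_Cons)
  also have "\<dots> = (\<Sum>i<c - Suc a. if sign_at k (Suc a + i) = (\<not> sign_at k a)
       then nc_count k (Suc a) (Suc a + i) * nc_count k (Suc (Suc a + i)) c else 0)"
    unfolding red_count_split nc_count_def
    by (intro sum.cong) (simp_all add: take_sign_interval drop_sign_interval nth_sign_interval)
  finally show ?thesis .
qed

text \<open>
  Over whole periods it does not matter where the circle is cut open.
\<close>

lemma nc_count_rotate: "nc_count k x (x + 2 * k * n) = nc_count k 0 (2 * k * n)"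
proof (induction x)
  case (Suc x)
  show ?case
  proof (cases "2 * k * n = 0")
    case True
    show ?thesis unfolding True by (simp add: nc_count_def sign_interval_def)
  next
    case False
    have "nc_count k (Suc x) (Suc x + 2 * k * n) = red_count (sign_interval k (Suc x) (x + 2 * k * n) @ [sign_at k x]) []"
      using False sign_interval_snoc[of "Suc x" "x + 2 * k * n" k] by (simp add: nc_count_def)
    also have "\<dots> = nc_count k x (x + 2 * k * n)"
    proof -
      have "x < x + 2 * k * n" using False by linarith
      then show ?thesis
        unfolding red_count_rotate nc_count_def by (simp only: sign_interval_Cons)
    qed
    finally show ?thesis using Suc.IH by simp
  qed
qed simp

text \<open>
  The interval starts with a step up from level \<open>l\<close>. By balance its partner is a step down to level \<open>l\<close>,
  and there is one of these behind each of the \<open>j\<close> peaks. Behind the partner of peak \<open>a\<close> remains a rotation of \<open>j - a\<close> whole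
  periods.
\<close>

lemma nc_count_level:
  assumes "l < k" "j \<ge> 1"
  shows "nc_count k l (2 * k * j - l) =
    (\<Sum>a=1..j. nc_count k (Suc l) (2 * k * a - Suc l) * nc_count k 0 (2 * k * (j - a)))"
proof -
  define c where "c = 2 * k * j - l"
  define g where "g i = (if sign_at k (Suc l + i) = (\<not> sign_at k l)
       then nc_count k (Suc l) (Suc l + i) * nc_count k (Suc (Suc l + i)) c else 0)" for i
  \<comment> \<open>The partner of the first position, counted from position \<open>l + 1\<close>, that lies behind peak \<open>a\<close>.\<close>
  define \<phi> where "\<phi> a = 2 * k * a - 2 * Suc l" for a
  have k: "k \<ge> 1" using assms by simp
  have arith: "A - 2 * Suc l < B - l - Suc l" if "A \<le> B" "2 * Suc l \<le> A" for A B
    using that by arith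
  have arith': "i = A - 2 * Suc l" if "Suc l + i = A - Suc l" for A i
    using that by arith
  have big: "2 * k * a \<ge> 2 * Suc l" if "a \<ge> 1" for a
  proof -
    have "2 * Suc l \<le> 2 * k * 1" using assms by simp
    also have "\<dots> \<le> 2 * k * a" using that by (intro mult_left_mono) auto
    finally show ?thesis .
  qed
  have "2 * k * j \<ge> 2 * Suc l" using big[OF assms(2)] .
  then have "l < c" by (simp add: c_def)
  then have "nc_count k l c = (\<Sum>i<c - Suc l. g i)"
    unfolding g_def by (rule nc_count_rec)
  also have "\<dots> = (\<Sum>i\<in>\<phi> ` {1..j}. g i)"
  proof (rule sum.mono_neutral_right)
    show "\<phi> ` {1..j} \<subseteq> {..<c - Suc l}"
    proof (rule image_subsetI, simp)
      fix a assume a: "Suc 0 \<le> a \<and> a \<le> j"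
      then have "2 * k * a \<le> 2 * k * j" by simp
      moreover have "2 * Suc l \<le> 2 * k * a" using a by (intro big) simp
      ultimately show "\<phi> a < c - Suc l"
        unfolding \<phi>_def c_def by (metis arith)
    qed
    show "\<forall>i\<in>{..<c - Suc l} - \<phi> ` {1..j}. g i = 0"
    proof (rule ballI, rule ccontr)
      fix i assume i: "i \<in> {..<c - Suc l} - \<phi> ` {1..j}" and "g i \<noteq> 0"
      define s where "s = Suc l + i"
      have s: "sign_at k s = (\<not> sign_at k l)" "nc_count k (Suc l) s \<noteq> 0"
        using \<open>g i \<noteq> 0\<close> unfolding g_def s_def by (auto split: if_splits)
      have "sign_at k l" using assms by (simp add: sign_at_def)
      have hl: "height k (Suc l) = Suc l" using assms by (simp add: height_def)
      have "height k s = Suc l"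
        using nc_count_height[OF k _ s(2)] hl s_def by linarith
      then have "s mod (2 * k) = 2 * k - Suc l"
        using s(1) \<open>sign_at k l\<close> assms mod_less_divisor[of "2 * k" s] by (auto simp: sign_at_def height_def split: if_splits)
      then have "s = 2 * k * (s div (2 * k)) + (2 * k - Suc l)"
        by (metis mult_div_mod_eq)
      then have sa: "s = 2 * k * (Suc (s div (2 * k))) - Suc l"
        using assms by simp
      define a where "a = Suc (s div (2 * k))"
      have eq: "Suc l + i = 2 * k * a - Suc l" using sa by (simp only: a_def s_def)
      from this have "i = \<phi> a" unfolding \<phi>_def by (rule arith')
      moreover have "a \<le> j"
      proof (rule ccontr)
        assume "\<not> a \<le> j"
        then have "2 * k * Suc j \<le> 2 * k * a" by (intro mult_left_mono) auto
        then have "2 * k * j + 2 * k \<le> 2 * k * a" by simp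
        moreover have "i < 2 * k * j - l - Suc l" using i by (simp add: c_def)
        ultimately show False using eq assms(1) by linarith
      qed
      ultimately show False using i by (auto simp: a_def)
    qed
  qed simp
  also have "\<dots> = (\<Sum>a=1..j. g (\<phi> a))"
  proof (rule sum.reindex_cong[of \<phi>])
    show "inj_on \<phi> {1..j}"
    proof (rule inj_onI)
      fix a a' assume "a \<in> {1..j}" "a' \<in> {1..j}" "\<phi> a = \<phi> a'"
      moreover from this have "2 * Suc l \<le> 2 * k * a" "2 * Suc l \<le> 2 * k * a'"
        using big[of a] big[of a'] by simp_all
      ultimately have "2 * k * a = 2 * k * a'" unfolding \<phi>_def by (metis eq_diff_iff)
      then show "a = a'" using k by simp
    qed
  qed auto
  also have "\<dots> = (\<Sum>a=1..j. nc_count k (Suc l) (2 * k * a - Suc l) * nc_count k 0 (2 * k * (j - a)))"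
  proof (rule sum.cong, simp)
    fix a assume a: "a \<in> {1..j}"
    have e: "Suc l + \<phi> a = 2 * k * a - Suc l" using big[of a] a by (simp add: \<phi>_def)
    have e1: "2 * k * a = 2 * k * (a - 1) + 2 * k" using a by (cases a) auto
    have "(2 * k * a - Suc l) mod (2 * k) = 2 * k - Suc l"
    proof -
      have "2 * k * a - Suc l = (2 * k - Suc l) + 2 * k * (a - 1)" using e1 assms by simp
      then show ?thesis using assms by (simp only: mod_mult_self2) simp
    qed
    then have "sign_at k (Suc l + \<phi> a) = (\<not> sign_at k l)"
      unfolding e using assms by (simp add: sign_at_def)
    moreover have "Suc (Suc l + \<phi> a) = 2 * k * a - l" using e big[of a] a by simp
    moreover have "nc_count k (2 * k * a - l) c = nc_count k 0 (2 * k * (j - a))"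
    proof -
      have "2 * k * a \<le> 2 * k * j" using a by simp
      then have "c = (2 * k * a - l) + 2 * k * (j - a)"
        using big[of a] a by (simp add: c_def diff_mult_distrib2)
      then show ?thesis using nc_count_rotate[of k "2 * k * a - l" "j - a"] by simp
    qed
    ultimately show "g (\<phi> a) = nc_count k (Suc l) (2 * k * a - Suc l) * nc_count k 0 (2 * k * (j - a))"
      unfolding g_def e by simp
  qed
  finally show ?thesis unfolding c_def .
qed

unbundle fps_syntax

definition nc_fps :: "nat \<Rightarrow> int fps" where
  "nc_fps k = Abs_fps (\<lambda>n. int (nc_count k 0 (2 * k * n)))"

text \<open>
  Going up one level contributes a factor \<open>nc_fps k\<close>; the \<open>k\<close> levels and the top, which is a rotated pattern
  with one peak less, give \<open>k + 1\<close> factors.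
\<close>

lemma nc_fps_eq:
  assumes "k \<ge> 1"
  shows "nc_fps k = 1 + fps_X * nc_fps k ^ Suc k"
proof -
  define S where "S l = Abs_fps (\<lambda>j. if j = 0 then 0 else int (nc_count k l (2 * k * j - l)))" for l
  have step: "S l = S (Suc l) * nc_fps k" if "l < k" for l
  proof (rule fps_ext)
    fix j
    show "S l $ j = (S (Suc l) * nc_fps k) $ j"
    proof (cases "j = 0")
      case False
      have "(S (Suc l) * nc_fps k) $ j = (\<Sum>i=0..j. S (Suc l) $ i * nc_fps k $ (j - i))"
        by (simp add: fps_mult_nth)
      also have "\<dots> = (\<Sum>i=1..j. S (Suc l) $ i * nc_fps k $ (j - i))"
        by (rule sum.mono_neutral_right) (auto simp: S_def)
      also have "\<dots> = int (nc_count k l (2 * k * j - l))"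
        using False that by (subst nc_count_level) (auto simp: S_def nc_fps_def intro!: sum.cong)
      finally show ?thesis using False by (simp add: S_def)
    qed (simp add: S_def fps_mult_nth)
  qed
  have top: "S k = fps_X * nc_fps k"
  proof (rule fps_ext)
    fix j
    show "S k $ j = (fps_X * nc_fps k) $ j"
    proof (cases j)
      case (Suc i)
      have "2 * k * j - k = k + 2 * k * i" using Suc by simp
      then show ?thesis using nc_count_rotate[of k k i] by (simp add: Suc S_def nc_fps_def)
    qed (simp add: S_def)
  qed
  have "S (k - i) = fps_X * nc_fps k ^ Suc i" if "i \<le> k" for i
    using that
  proof (induction i)
    case (Suc i)
    have "S (k - Suc i) = S (Suc (k - Suc i)) * nc_fps k" using Suc.prems by (intro step) simp
    also have "Suc (k - Suc i) = k - i" using Suc.prems by simp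
    finally show ?case using Suc by (simp add: algebra_simps)
  qed (simp add: top)
  from this[of k] have "S 0 = fps_X * nc_fps k ^ Suc k" by simp
  moreover have "nc_fps k = 1 + S 0"
    by (rule fps_ext) (auto simp: S_def nc_fps_def nc_count_def sign_interval_def)
  ultimately show ?thesis by simp
qed

text \<open>
  The equation for \<open>T\<close> yields \<open>T^(x+1) = T^x + X * T^(x+k+1)\<close>. Written as a difference of two binomial
  coefficients (as in the ballot problem), the Raney numbers satisfy the corresponding recursion by Pascal's rule.
\<close>

lemma raney_coeff:
  fixes T :: "int fps"
  assumes T: "T = 1 + fps_X * T ^ Suc k"
  shows "(T ^ x) $ Suc n =
    int ((x + Suc n * Suc k - 1) choose Suc n) - int k * int ((x + Suc n * Suc k - 1) choose n)"
proof -
  have T0: "T $ 0 = 1" by (subst T) simp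
  have rec: "(T ^ Suc x) $ Suc n = (T ^ x) $ Suc n + (T ^ (x + Suc k)) $ n" for x n
  proof -
    have "T ^ Suc x = T ^ x * (1 + fps_X * T ^ Suc k)" using T by simp
    also have "\<dots> = T ^ x + fps_X * T ^ (x + Suc k)" by (simp add: algebra_simps power_add)
    finally show ?thesis by simp
  qed
  \<comment> \<open>The case \<open>x = 0\<close>, where \<open>T^0 = 1\<close> has no terms of positive degree.\<close>
  have base: "int ((Suc n * Suc k - 1) choose Suc n) = int k * int ((Suc n * Suc k - 1) choose n)" for n
  proof -
    define N where "N = Suc n * Suc k - 1"
    have "Suc n * (N choose Suc n) = (N - n) * (N choose n)"
      using binomial_absorb_comp[of N n] binomial_absorption[of n N] by simp
    also have "N - n = Suc n * k" by (simp add: N_def algebra_simps)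
    finally have "N choose Suc n = k * (N choose n)" by (metis mult.assoc mult_cancel1 nat.distinct(1))
    then show ?thesis by (simp add: N_def)
  qed
  show ?thesis
  proof (induction n arbitrary: x)
    case 0
    show ?case
    proof (induction x)
      case (Suc x)
      then show ?case by (subst rec) (auto simp: fps_power_zeroth T0)
    qed (use base[of 0] in simp)
  next
    case (Suc n)
    note IH = Suc.IH
    show ?case
    proof (induction x)
      case 0
      then show ?case using base[of "Suc n"] by simp
    next
      case (Suc x)
      define N where "N = x + Suc (Suc n) * Suc k - 1"
      have N: "Suc x + Suc (Suc n) * Suc k - 1 = Suc N" by (simp add: N_def)
      have N': "x + Suc k + Suc n * Suc k - 1 = N" by (simp add: N_def)
      show ?case
        unfolding rec Suc.IH IH[of "x + Suc k"] N N' N_def[symmetric]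
        by (simp add: algebra_simps)
    qed
  qed
qed

lemma nc_count_eq_fuss_catalan:
  assumes "k \<ge> 1"
  shows "real (nc_count k 0 (2 * k * m)) = fuss_catalan k m"
proof (cases m)
  case 0
  then show ?thesis by (simp add: nc_count_def sign_interval_def fuss_catalan_def)
next
  case (Suc n)
  define N where "N = Suc k * m"
  have "Suc n * (N choose Suc n) = (N - n) * (N choose n)"
    using binomial_absorb_comp[of N n] binomial_absorption[of n N] by simp
  moreover have "N - n = k * m + 1" by (simp add: N_def Suc)
  ultimately have "m * (N choose m) = (k * m + 1) * (N choose n)" by (simp add: Suc)
  then have 1: "real m * real (N choose m) = (real k * real m + 1) * real (N choose n)"
    by (metis of_nat_mult of_nat_add of_nat_1)
  have "int (nc_count k 0 (2 * k * m)) = nc_fps k $ m" by (simp add: nc_fps_def)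
  also have "\<dots> = int (N choose m) - int k * int (N choose n)"
    using raney_coeff[OF nc_fps_eq[OF assms], of 1 n] by (simp add: N_def Suc mult.commute)
  finally have "real (nc_count k 0 (2 * k * m)) = real (N choose m) - real k * real (N choose n)"
    by (metis of_int_of_nat_eq of_int_diff of_int_mult)
  moreover have "real k * real m + 1 > 0" by (simp add: add_nonneg_pos)
  ultimately have "real (nc_count k 0 (2 * k * m)) * (real k * real m + 1) = real (N choose m)"
  proof -
    have "(real (N choose m) - real k * real (N choose n)) * (real k * real m + 1) =
        real (N choose m) * (real k * real m + 1) - real k * ((real k * real m + 1) * real (N choose n))"
      by (simp add: algebra_simps)
    also have "\<dots> = real (N choose m)" unfolding 1[symmetric] by (simp add: algebra_simps)
    finally show ?thesis using \<open>real (nc_count k 0 (2 * k * m)) = _\<close> by simp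
  qed
  then show ?thesis
    using \<open>real k * real m + 1 > 0\<close> by (simp add: fuss_catalan_def N_def field_simps)
qed

unbundle no fps_syntax

text \<open>
  The exponential growth rate of the Fuss-Catalan numbers.
\<close>

definition growth :: "nat \<Rightarrow> real" where
  "growth k = real (Suc k) ^ Suc k / real k ^ k"

lemma growth_ge_1: "k \<ge> 1 \<Longrightarrow> growth k \<ge> 1"
proof -
  assume "k \<ge> 1"
  have "real k ^ k \<le> real (Suc k) ^ k" by (intro power_mono) auto
  also have "\<dots> \<le> real (Suc k) ^ Suc k" by (intro power_increasing) auto
  finally show ?thesis using \<open>k \<ge> 1\<close> by (simp add: growth_def)
qed

text \<open>
  Among the \<open>N + 1\<close> terms of the binomial expansion of \<open>(1 + k)^N\<close>, \<open>N = (k+1) m\<close>, the one at \<open>j = m\<close> is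
  the largest.
\<close>

lemma fuss_binomial_bounds:
  assumes "k \<ge> 1"
  shows "real ((Suc k * m) choose m) \<le> growth k ^ m"
    and "growth k ^ m \<le> real (Suc k * m + 1) * real ((Suc k * m) choose m)"
proof -
  define N where "N = Suc k * m"
  define a where "a j = (N choose j) * k ^ (N - j)" for j
  have km: "N - m = k * m" by (simp add: N_def)
  have sum_a: "Suc k ^ N = (\<Sum>j\<le>N. a j)"
    using binomial_ring[of "1::nat" k N] by (simp add: a_def)
  have pw: "growth k ^ m * real k ^ (k * m) = real (Suc k ^ N)"
  proof -
    have "growth k ^ m * real k ^ (k * m) = (growth k * real k ^ k) ^ m"
      by (simp only: power_mult power_mult_distrib)
    also have "growth k * real k ^ k = real (Suc k) ^ Suc k"
      using assms by (simp add: growth_def)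
    also have "(real (Suc k) ^ Suc k) ^ m = real (Suc k ^ N)"
      by (simp only: N_def power_mult of_nat_power)
    finally show ?thesis .
  qed
  have kpos: "real k ^ (k * m) > 0" using assms by simp
  have "a m \<le> Suc k ^ N"
    unfolding sum_a by (intro member_le_sum) (auto simp: N_def)
  then have "real ((Suc k * m) choose m) * real k ^ (k * m) \<le> growth k ^ m * real k ^ (k * m)"
    unfolding pw a_def km N_def[symmetric] by (metis of_nat_le_iff of_nat_mult of_nat_power)
  then show "real ((Suc k * m) choose m) \<le> growth k ^ m" using kpos by simp
  have ratio: "Suc j * k * a (Suc j) = (N - j) * a j" if "j < N" for j
  proof -
    have "Suc j * (N choose Suc j) = (N - j) * (N choose j)"
      using binomial_absorb_comp[of N j] binomial_absorption[of j N] by simp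
    moreover have "k ^ (N - j) = k * k ^ (N - Suc j)"
      using that by (simp add: Suc_diff_Suc flip: power_Suc)
    ultimately show ?thesis
      unfolding a_def by (metis (no_types, lifting) mult.assoc mult.commute)
  qed
  have up: "a j \<le> a m" if "j \<le> m" for j
    using that
  proof (induction rule: inc_induct)
    case (step j)
    have "j < N" using step.hyps by (auto simp: N_def intro: less_le_trans)
    have "Suc k * Suc j \<le> N" unfolding N_def using step.hyps by (intro mult_left_mono) auto
    then have "Suc j * k + j \<le> N" by (simp add: algebra_simps)
    then have "Suc j * k \<le> N - j" by linarith
    then have "Suc j * k * a j \<le> Suc j * k * a (Suc j)"
      unfolding ratio[OF \<open>j < N\<close>] by (rule mult_right_mono) simp
    then have "a j \<le> a (Suc j)" using assms by simp
    then show ?case using step by simp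
  qed simp
  have down: "a j \<le> a m" if "m \<le> j" "j \<le> N" for j
    using that
  proof (induction rule: dec_induct)
    case (step j)
    have "j < N" using step by simp
    have "N \<le> Suc k * j" unfolding N_def using step.hyps by (intro mult_left_mono) auto
    then have "N \<le> Suc j * k + j" by (simp add: algebra_simps)
    then have "N - j \<le> Suc j * k" by linarith
    then have "Suc j * k * a (Suc j) \<le> Suc j * k * a j"
      unfolding ratio[OF \<open>j < N\<close>] by (rule mult_right_mono) simp
    then have "a (Suc j) \<le> a j" using assms by simp
    then show ?case using step by simp
  qed simp
  have "Suc k ^ N \<le> (\<Sum>j\<le>N. a m)"
    unfolding sum_a using up down by (intro sum_mono) (metis atMost_iff nle_le)
  also have "\<dots> = (N + 1) * a m" by simp
  finally have "real (Suc k ^ N) \<le> real ((N + 1) * a m)" by (simp only: of_nat_le_iff)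
  then have "growth k ^ m * real k ^ (k * m) \<le> (real (Suc k * m + 1) * real ((Suc k * m) choose m)) * real k ^ (k * m)"
    unfolding pw a_def km by (simp add: N_def algebra_simps)
  then show "growth k ^ m \<le> real (Suc k * m + 1) * real ((Suc k * m) choose m)" using kpos by (simp only: mult_le_cancel_right_pos)
qed

text \<open>
  Enlarged to whole blocks, an interval of the pattern equals its own reversed negative, so its squared norm is a Fuss-Catalan
  number for twice as many blocks. The exponent is the number of blocks that the enlarged interval occupies.
\<close>

lemma sqrt_sq_norm_interval:
  assumes "k \<ge> 1" "a \<le> c"
  shows "sqrt (real (sq_norm (sign_interval k a c))) \<le> growth k ^ (c div (2 * k) + 1 - a div (2 * k))"
proof -
  define u where "u = a div (2 * k)"
  define n where "n = c div (2 * k) + 1 - u"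
  have un: "u + n = c div (2 * k) + 1"
    using assms div_le_mono[of a c "2 * k"] by (simp add: u_def n_def)
  have lo: "2 * k * u \<le> a" by (simp add: u_def)
  have "c < 2 * k * (c div (2 * k) + 1)"
    using assms dividend_less_times_div[of "2 * k" c] by simp
  then have hi: "c \<le> 2 * k * (u + n)" by (simp only: un)
  have "sign_interval k (2 * k * u) (2 * k * (u + n)) =
      sign_interval k (2 * k * u) a @ sign_interval k a c @ sign_interval k c (2 * k * (u + n))"
    using lo hi assms sign_interval_append[of "2 * k * u" a "2 * k * (u + n)" k] sign_interval_append[of a c "2 * k * (u + n)" k]
    by simp
  moreover have "sign_interval k (2 * k * u) (2 * k * (u + n)) = sign_interval k 0 (2 * k * n)"
    using sign_interval_shift[of k 0 u "2 * k * n"] by (simp add: algebra_simps)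
  ultimately have "sq_norm (sign_interval k a c) \<le> sq_norm (sign_interval k 0 (2 * k * n))"
    using sq_norm_sublist by metis
  also have "flip_rev (sign_interval k 0 (2 * k * n)) = sign_interval k 0 (2 * k * n)"
  proof (rule nth_equalityI)
    fix i assume i: "i < length (flip_rev (sign_interval k 0 (2 * k * n)))"
    then have i': "i < 2 * k * n" by simp
    define r where "r = i mod (2 * k)"
    define q where "q = i div (2 * k)"
    have iq: "i = 2 * k * q + r" by (simp add: r_def q_def)
    have r: "r < 2 * k" using assms by (simp add: r_def)
    have "q < n" unfolding q_def using i' assms by (simp add: div_less_iff_less_mult mult.commute)
    then have "2 * k * n = 2 * k * ((n - Suc q) + q + 1)" by simp
    then have "2 * k * n = 2 * k * (n - Suc q) + 2 * k * q + 2 * k" by (simp only: distrib_left mult_1_right)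
    then have "2 * k * n - Suc i = (2 * k - Suc r) + 2 * k * (n - Suc q)"
      using r by (simp add: iq)
    then have "(2 * k * n - Suc i) mod (2 * k) = 2 * k - Suc r"
      using r by (simp only: mod_mult_self2) simp
    then have "sign_at k (2 * k * n - Suc i) \<longleftrightarrow> \<not> sign_at k i"
      using r by (auto simp: sign_at_def r_def[symmetric])
    then show "flip_rev (sign_interval k 0 (2 * k * n)) ! i = sign_interval k 0 (2 * k * n) ! i"
      using i' by (simp add: flip_rev_def rev_nth nth_sign_interval)
  qed simp
  then have "sq_norm (sign_interval k 0 (2 * k * n)) = red_count (sign_interval k 0 (2 * k * n) @ sign_interval k 0 (2 * k * n)) []"
    by (simp add: sq_norm_eq)
  also have "sign_interval k 0 (2 * k * n) @ sign_interval k 0 (2 * k * n) = sign_interval k 0 (2 * k * (2 * n))"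
    using sign_interval_append[of 0 "2 * k * n" "2 * k * (2 * n)" k] sign_interval_shift[of k 0 n "2 * k * n"]
    by (simp add: mult_2 distrib_left)
  finally have "sq_norm (sign_interval k a c) \<le> nc_count k 0 (2 * k * (2 * n))"
    by (simp add: nc_count_def)
  then have "real (sq_norm (sign_interval k a c)) \<le> fuss_catalan k (2 * n)"
    using nc_count_eq_fuss_catalan[OF assms(1), of "2 * n"] by simp
  also have "\<dots> \<le> real ((Suc k * (2 * n)) choose (2 * n))"
    by (simp add: fuss_catalan_def divide_le_eq mult_le_cancel_left1 flip: of_nat_Suc) 
  also have "\<dots> \<le> growth k ^ (2 * n)" by (rule fuss_binomial_bounds[OF assms(1)])
  finally have "real (sq_norm (sign_interval k a c)) \<le> (growth k ^ n)\<^sup>2"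
    by (simp only: power_even_eq)
  then have "sqrt (real (sq_norm (sign_interval k a c))) \<le> growth k ^ n"
    using growth_ge_1[OF assms(1)] by (intro real_le_lsqrt) auto
  then show ?thesis by (simp add: n_def u_def)
qed

lemma growth_le_fuss_catalan:
  assumes "k \<ge> 1"
  shows "growth k ^ m \<le> real (k * m + 1) * real (Suc k * m + 1) * fuss_catalan k m"
proof -
  have "real (k * m + 1) * fuss_catalan k m = real ((Suc k * m) choose m)"
    by (simp add: fuss_catalan_def del: of_nat_add of_nat_mult of_nat_Suc)
  then show ?thesis
    using fuss_binomial_bounds(2)[OF assms, of m] by (metis mult.assoc mult.commute)
qed

section \<open>Peeling off vertices that are visited once\<close>

text \<open>
  A walk is given by its base point and the list of its steps; a step is its sign and the vertex that
  it leads to.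
\<close>

type_synonym letters = "(bool \<times> nat) list"

definition verts :: "nat \<Rightarrow> letters \<Rightarrow> nat list" where
  "verts b X = b # map snd X"

fun walk_edges :: "nat \<Rightarrow> letters \<Rightarrow> (nat \<times> nat) list" where
  "walk_edges b [] = []"
| "walk_edges b ((s, x) # X) = (if s then (b, x) else (x, b)) # walk_edges x X"

definition edges_repeated :: "nat \<Rightarrow> letters \<Rightarrow> bool" where
  "edges_repeated b X \<longleftrightarrow> (\<forall>e \<in> set (walk_edges b X). count_list (walk_edges b X) e \<ge> 2)"

definition closed_walk :: "nat \<Rightarrow> letters \<Rightarrow> bool" where
  "closed_walk b X \<longleftrightarrow> last (verts b X) = b"

lemma set_verts: "set (verts b X) = insert b (snd ` set X)"
  by (simp add: verts_def)

lemma last_verts_in: "last (verts b X) \<in> set (verts b X)"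
  by (rule last_in_set) (simp add: verts_def)

lemma last_verts_Cons [simp]: "last (verts b (l # X)) = last (verts (snd l) X)"
  by (simp add: verts_def)

lemma last_verts_append: "last (verts b (X @ Y)) = last (verts (last (verts b X)) Y)"
  by (simp add: verts_def)

lemma walk_edges_append: "walk_edges b (X @ Y) = walk_edges b X @ walk_edges (last (verts b X)) Y"
  by (induction b X rule: walk_edges.induct) (auto simp: verts_def)

lemma walk_edges_subset:
  "e \<in> set (walk_edges b X) \<Longrightarrow> fst e \<in> set (verts b X) \<and> snd e \<in> set (verts b X)"
  by (induction b X rule: walk_edges.induct) (auto simp: verts_def split: if_splits)

lemma length_walk_edges [simp]: "length (walk_edges b X) = length X"
  by (induction b X rule: walk_edges.induct) auto

text \<open>
  A vertex visited once meets only the two steps \<open>l\<close> and \<open>m\<close>. Their edges occur twice, so they are the same edge; it is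
  not a loop, so it is traversed back and forth. No other step uses it.
\<close>

lemma fresh_vertex_backtracks:
  assumes edges_repeated: "edges_repeated b (pre @ l # m # Y)"
    and fresh: "snd l \<notin> set (verts b pre)" "snd l \<notin> snd ` set (m # Y)"
  shows "fst m = (\<not> fst l)" "snd m = last (verts b pre)" "edges_repeated b (pre @ Y)"
proof -
  obtain s x where l: "l = (s, x)" by force
  obtain s' z where m: "m = (s', z)" by force
  define y where "y = last (verts b pre)"
  have xy: "x \<noteq> y" using fresh(1) last_verts_in[of b pre] by (auto simp: l y_def)
  have xz: "x \<noteq> z" using fresh(2) by (simp add: l m)
  define v where "v = (if s then (y, x) else (x, y))"
  define v' where "v' = (if s' then (x, z) else (z, x))"
  have walk_edges: "walk_edges b (pre @ l # m # Y) = walk_edges b pre @ v # v' # walk_edges z Y"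
    by (simp add: walk_edges_append l m v_def v'_def y_def)
  have no1: "e \<noteq> v" if "e \<in> set (walk_edges b pre)" for e
    using walk_edges_subset[OF that] fresh(1) by (auto simp: v_def l)
  have no2: "e \<noteq> v" if "e \<in> set (walk_edges z Y)" for e
  proof -
    have "x \<notin> set (verts z Y)" using fresh(2) xz by (auto simp: l m set_verts image_iff)
    then show ?thesis using walk_edges_subset[OF that] by (auto simp: v_def)
  qed
  have "count_list (walk_edges b (pre @ l # m # Y)) v \<ge> 2"
    using edges_repeated unfolding edges_repeated_def walk_edges by simp
  moreover have "count_list (walk_edges b pre) v = 0" "count_list (walk_edges z Y) v = 0"
    using no1[of v] no2[of v] by (meson count_list_0_iff)+
  ultimately have "v = v'" by (auto simp: walk_edges split: if_splits)
  then have s: "s' = (\<not> s)" and z: "z = y" using xy xz by (auto simp: v_def v'_def split: if_splits)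
  then show "fst m = (\<not> fst l)" "snd m = last (verts b pre)" by (auto simp: l m y_def)
  show "edges_repeated b (pre @ Y)"
    unfolding edges_repeated_def
  proof
    fix e assume e: "e \<in> set (walk_edges b (pre @ Y))"
    then have "e \<in> set (walk_edges b pre) \<or> e \<in> set (walk_edges z Y)"
      by (auto simp: walk_edges_append z y_def)
    then have "e \<noteq> v" "e \<in> set (walk_edges b (pre @ l # m # Y))" using no1[of e] no2[of e] by (auto simp: walk_edges)
    then have "count_list (walk_edges b (pre @ l # m # Y)) e \<ge> 2" using edges_repeated unfolding edges_repeated_def by blast
    with \<open>e \<noteq> v\<close> show "count_list (walk_edges b (pre @ Y)) e \<ge> 2"
      unfolding walk_edges by (simp add: walk_edges_append z[symmetric] \<open>v = v'\<close>[symmetric] y_def[symmetric])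
  qed
qed

text \<open>
  Steps are processed from the last to the first. \<open>pre\<close> holds the steps still to come, and the result is the
  walk that remains of the others, so that \<open>pre\<close> followed by the result is the current walk. A step is cancelled against the first
  remaining one if the vertex between them occurs nowhere else in the current walk. The Booleans are
  those of \<open>reductions\<close>.
\<close>

fun peel :: "nat \<Rightarrow> letters \<Rightarrow> letters \<Rightarrow> bool list \<times> letters" where
  "peel b pre [] = ([], [])"
| "peel b pre (l # X) = (case peel b (pre @ [l]) X of (d, st) \<Rightarrow>
     if st \<noteq> [] \<and> snd l \<notin> set (verts b pre) \<and> snd l \<notin> snd ` set st
     then (False # d, tl st) else (True # d, l # st))"

lemma length_fst_peel: "length (fst (peel b pre X)) = length X"
  by (induction b pre X rule: peel.induct) (auto split: prod.split if_splits)

text \<open>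
  A cancellation removes one vertex and two steps, and with them one visit to the vertex \<open>y\<close> in front of the
  pair. Unless \<open>y\<close> is the base point, the last step of \<open>pre\<close> ends at \<open>y\<close>, so that any later visit to \<open>y\<close> still has a
  companion.
\<close>

lemma peel_correct:
  assumes "peel b pre X = (d, st)" "edges_repeated b (pre @ X)" "closed_walk b (pre @ X)"
  shows "edges_repeated b (pre @ st) \<and> closed_walk b (pre @ st) \<and> d \<in> reductions (map fst X) (map fst st) \<and>
    (\<forall>l\<in>set st. snd l = b \<or> count_list (map snd (pre @ st)) (snd l) \<ge> 2) \<and>
    2 * card (set (verts b (pre @ st))) + length X = 2 * card (set (verts b (pre @ X))) + length st"
  using assms
proof (induction X arbitrary: pre d st)
  case Nil
  then show ?case by auto
next
  case (Cons l X)
  obtain d1 st1 where p: "peel b (pre @ [l]) X = (d1, st1)" by force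
  have IH: "edges_repeated b (pre @ l # st1)" "closed_walk b (pre @ l # st1)"
    "d1 \<in> reductions (map fst X) (map fst st1)"
    "\<forall>m\<in>set st1. snd m = b \<or> count_list (map snd (pre @ l # st1)) (snd m) \<ge> 2"
    "2 * card (set (verts b (pre @ l # st1))) + length X = 2 * card (set (verts b (pre @ l # X))) + length st1"
    using Cons.IH[OF p] Cons.prems(2,3) by auto
  show ?case
  proof (cases "st1 \<noteq> [] \<and> snd l \<notin> set (verts b pre) \<and> snd l \<notin> snd ` set st1")
    case True
    then obtain m Y where st1: "st1 = m # Y" by (cases st1) auto
    have st: "st = Y" "d = False # d1" using Cons.prems(1) True by (auto simp: p st1)
    have fresh: "snd l \<notin> set (verts b pre)" "snd l \<notin> snd ` set (m # Y)" using True by (auto simp: st1)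
    note backs = fresh_vertex_backtracks[OF IH(1)[unfolded st1] fresh]
    have "closed_walk b (pre @ Y)"
      using IH(2) backs(2) unfolding closed_walk_def by (simp add: st1 last_verts_append)
    moreover have "d \<in> reductions (map fst (l # X)) (map fst Y)"
      using IH(3) backs(1) by (simp add: st st1)
    moreover have "snd u = b \<or> count_list (map snd (pre @ Y)) (snd u) \<ge> 2" if u: "u \<in> set Y" for u
    proof (cases "snd u = b")
      case False
      then have c: "count_list (map snd (pre @ l # st1)) (snd u) \<ge> 2" using IH(4) u by (auto simp: st1)
      have "snd u \<noteq> snd l" using fresh(2) u by (metis image_eqI list.set_intros(2))
      show ?thesis
      proof (cases "snd u = snd m")
        case True
        then have "snd u \<in> snd ` set pre"
          using backs(2) last_verts_in[of b pre] False by (auto simp: set_verts)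
        then have "count_list (map snd pre) (snd u) \<noteq> 0" by (auto simp: count_list_0_iff)
        moreover have "count_list (map snd Y) (snd u) \<noteq> 0" using u by (auto simp: count_list_0_iff)
        ultimately show ?thesis by simp
      next
        case False
        then show ?thesis using c \<open>snd u \<noteq> snd l\<close> by (simp add: st1)
      qed
    qed simp
    moreover have "set (verts b (pre @ l # st1)) = insert (snd l) (set (verts b (pre @ Y)))"
      using backs(2) last_verts_in[of b pre] by (auto simp: st1 set_verts)
    then have "card (set (verts b (pre @ l # st1))) = Suc (card (set (verts b (pre @ Y))))"
      using fresh by (subst card_insert_disjoint[symmetric]) (auto simp: set_verts image_Un)
    ultimately show ?thesis using backs(3) IH(5) by (auto simp: st st1)
  next
    case False
    have st: "st = l # st1" "d = True # d1" using Cons.prems(1) False by (auto simp: p split: if_splits)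
    have "snd l = b \<or> count_list (map snd (pre @ st)) (snd l) \<ge> 2"
    proof (cases "snd l = b")
      case neq: False
      have "st1 \<noteq> []"
      proof
        assume "st1 = []"
        then show False using IH(2) neq by (simp add: closed_walk_def last_verts_append verts_def)
      qed
      then have "snd l \<in> snd ` set pre \<or> snd l \<in> snd ` set st1"
        using False neq by (auto simp: set_verts)
      then have "count_list (map snd pre) (snd l) \<noteq> 0 \<or> count_list (map snd st1) (snd l) \<noteq> 0"
        by (auto simp: count_list_0_iff)
      then show ?thesis by (auto simp: st)
    qed simp
    then show ?thesis using IH by (auto simp: st)
  qed
qed

text \<open>
  Undoing a cancellation inserts a new vertex and a return to the vertex before it, so a relabelling of the smaller
  walks extends to the larger ones.
\<close>

lemma peel_determines:
  assumes "peel b pre X = (d, st)" "edges_repeated b (pre @ X)" "closed_walk b (pre @ X)"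
    and "peel b' pre' X' = (d, st')" "edges_repeated b' (pre' @ X')" "closed_walk b' (pre' @ X')"
    and "length pre = length pre'"
    and "(verts b (pre @ st), verts b' (pre' @ st')) \<in> relabel_rel"
  shows "(verts b (pre @ X), verts b' (pre' @ X')) \<in> relabel_rel"
  using assms
proof (induction X arbitrary: pre d st pre' X' st')
  case Nil
  then have "d = []" by simp
  then have "X' = []" using length_fst_peel[of b' pre' X'] Nil by simp
  then show ?case using Nil by simp
next
  case (Cons l X)
  have "length X' = Suc (length X)"
    using length_fst_peel[of b' pre' X'] length_fst_peel[of b pre "l # X"] Cons.prems by simp
  then obtain l' X1' where X': "X' = l' # X1'" by (cases X') auto
  obtain d1 st1 where p: "peel b (pre @ [l]) X = (d1, st1)" by force
  obtain d1' st1' where p': "peel b' (pre' @ [l']) X1' = (d1', st1')" by force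
  have d: "d1 = d1'" using Cons.prems(1,4) by (auto simp: p p' X' split: if_splits)
  have A: "edges_repeated b (pre @ l # st1)" "edges_repeated b' (pre' @ l' # st1')"
    using peel_correct[OF p] peel_correct[OF p'] Cons.prems by (auto simp: X')
  have "(verts b (pre @ l # st1), verts b' (pre' @ l' # st1')) \<in> relabel_rel"
  proof (cases "hd d")
    case True
    then have "st = l # st1" "st' = l' # st1'" using Cons.prems(1,4) by (auto simp: p p' X' split: if_splits)
    then show ?thesis using Cons.prems by simp
  next
    case False
    then have ne: "st1 \<noteq> []" "st1' \<noteq> []" using Cons.prems(1,4) by (auto simp: p p' X' split: if_splits)
    then obtain m m' where m: "st1 = m # st" "st1' = m' # st'"
      using Cons.prems(1,4) False by (cases st1; cases st1') (auto simp: p p' X' split: if_splits)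
    have fresh: "snd l \<notin> set (verts b pre)" "snd l \<notin> snd ` set (m # st)"
      and fresh': "snd l' \<notin> set (verts b' pre')" "snd l' \<notin> snd ` set (m' # st')"
      using Cons.prems(1,4) False m by (auto simp: p p' X' split: if_splits)
    have backs: "snd m = last (verts b pre)" "snd m' = last (verts b' pre')"
      using fresh_vertex_backtracks(2)[OF A(1)[unfolded m] fresh]
        fresh_vertex_backtracks(2)[OF A(2)[unfolded m] fresh'] by auto
    obtain f where f: "inj_on f (set (verts b (pre @ st)))" "verts b' (pre' @ st') = map f (verts b (pre @ st))"
      using Cons.prems(8) by (auto simp: relabel_rel_def)
    have f1: "verts b' pre' = map f (verts b pre)" "map snd st' = map f (map snd st)"
      using f(2) Cons.prems(7) by (auto simp: verts_def)
    define g where "g = f(snd l := snd l')"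
    have gf: "g x = f x" if "x \<in> set (verts b (pre @ st))" for x
      using that fresh by (auto simp: g_def set_verts)
    have last: "f (last (verts b pre)) = last (verts b' pre')"
      unfolding f1(1) by (simp add: verts_def last_map)
    have S: "set (verts b (pre @ l # m # st)) = insert (snd l) (set (verts b (pre @ st)))"
      using backs last_verts_in[of b pre] by (auto simp: set_verts)
    have img: "f ` set (verts b (pre @ st)) = set (verts b' (pre' @ st'))"
      using f(2) by simp
    have "verts b' (pre' @ l' # m' # st') = map g (verts b (pre @ l # m # st))"
    proof -
      have "map g (verts b pre) = verts b' pre'" unfolding f1(1) by (rule map_cong[OF refl], rule gf) (auto simp: set_verts)
      moreover have "map g (map snd st) = map snd st'" unfolding f1(2) by (rule map_cong[OF refl], rule gf) (auto simp: set_verts)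
      moreover have "g (snd m) = snd m'" unfolding backs last[symmetric]
        using last_verts_in[of b pre] by (intro gf) (auto simp: set_verts)
      ultimately show ?thesis by (simp add: verts_def) (simp add: g_def)
    qed
    moreover have "inj_on g (set (verts b (pre @ l # m # st)))"
    proof -
      have "inj_on g (set (verts b (pre @ st)))" using f(1) gf by (simp cong: inj_on_cong)
      moreover have "g (snd l) \<notin> g ` set (verts b (pre @ st))"
      proof -
        have "g ` set (verts b (pre @ st)) = set (verts b' (pre' @ st'))"
          unfolding img[symmetric] by (rule image_cong) (auto simp: gf)
        then show ?thesis using fresh' by (auto simp: g_def set_verts)
      qed
      ultimately show ?thesis unfolding S by auto
    qed
    ultimately show ?thesis unfolding relabel_rel_def m by blast
  qed
  then have "(verts b ((pre @ [l]) @ st1), verts b' ((pre' @ [l']) @ st1')) \<in> relabel_rel" by simp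
  from Cons.IH[OF p _ _ _ _ _ _ this, of X1'] show ?case
    using p' d Cons.prems by (simp add: X')
qed

section \<open>Reduced walks\<close>

text \<open>
  What remains after peeling, indexed by positions: corner \<open>i\<close> is the vertex \<open>w i\<close>, and step \<open>i\<close> leads from corner \<open>i\<close> to
  corner \<open>i + 1\<close> along the edge \<open>e i\<close>.
\<close>

locale reduced_walk =
  fixes n :: nat and w :: "nat \<Rightarrow> nat" and sg :: "nat \<Rightarrow> bool" and e :: "nat \<Rightarrow> nat \<times> nat"
  assumes e_def: "\<And>i. e i = (if sg i then (w i, w (Suc i)) else (w (Suc i), w i))"
    and closed: "w n = w 0"
    and twice: "\<And>i. i < n \<Longrightarrow> \<exists>j<n. j \<noteq> i \<and> e j = e i"
    and revisit: "\<And>i. 0 < i \<Longrightarrow> i < n \<Longrightarrow> w i \<noteq> w 0 \<Longrightarrow> \<exists>j<n. j \<noteq> i \<and> w j = w i"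
begin

definition visits :: "nat \<Rightarrow> nat set" where
  "visits x = {i. i < n \<and> w i = x}"

text \<open>
  Near a vertex that is not special the walk looks like two strands passing through it, and the second strand
  uses the same two edges as the first.
\<close>

definition special :: "nat \<Rightarrow> bool" where
  "special x \<longleftrightarrow> x = w 0 \<or> card (visits x) \<noteq> 2 \<or> (\<exists>i. 0 < i \<and> i < n \<and> w i = x \<and> e (i - 1) = e i)"

lemma finite_visits [simp]: "finite (visits x)"
  by (simp add: visits_def)

lemma edge_ends: "e i = e j \<Longrightarrow> {w i, w (Suc i)} = {w j, w (Suc j)}"
  by (auto simp: e_def split: if_splits)

text \<open>
  Around a vertex with the two visits \<open>i\<close> and \<open>j\<close> there are four steps. A loop at the vertex would have
  to be used twice and produce a third visit, so the four steps are distinct, and each of their edges occurs at least twice among them.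
\<close>

lemma corner_cases:
  assumes "x \<noteq> w 0" "visits x = {i, j}" "i \<noteq> j"
  shows "0 < i" "0 < j" "i < n" "j < n" "w i = x" "w j = x"
    and "t < n \<Longrightarrow> w t = x \<or> w (Suc t) = x \<Longrightarrow> t \<in> {i - 1, i, j - 1, j}"
    and "Suc i \<noteq> j" "Suc j \<noteq> i"
    and "t \<in> {i - 1, i, j - 1, j} \<Longrightarrow> \<exists>u\<in>{i - 1, i, j - 1, j}. u \<noteq> t \<and> e u = e t"
    and "w (Suc i) \<noteq> x" "w (i - 1) \<noteq> x" "w (Suc j) \<noteq> x" "w (j - 1) \<noteq> x"
proof -
  have ij: "i \<in> visits x" "j \<in> visits x" using assms by auto
  then show i: "i < n" "j < n" "w i = x" "w j = x" by (auto simp: visits_def)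
  show i0: "0 < i" "0 < j" using i assms(1) by (auto intro!: Nat.gr0I)
  have v: "t \<in> {i, j}" if "t < n" "w t = x" for t
    using that assms(2) by (auto simp: visits_def)
  have touch: "t \<in> {i - 1, i, j - 1, j}" if "t < n" "w t = x \<or> w (Suc t) = x" for t
  proof (cases "w t = x")
    case False
    then have "w (Suc t) = x" using that by simp
    then have "Suc t < n" using that closed assms(1) by (metis Suc_lessI)
    then show ?thesis using v[of "Suc t"] \<open>w (Suc t) = x\<close> by auto
  qed (use v[of t] that in auto)
  then show "t < n \<Longrightarrow> w t = x \<or> w (Suc t) = x \<Longrightarrow> t \<in> {i - 1, i, j - 1, j}" by simp
  have noloop: False if "w a = x" "w (Suc a) = x" "a < n" for a
  proof -
    have an: "a < n" by fact
    obtain b where b: "b < n" "b \<noteq> a" "e b = e a" using twice[OF an] by auto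
    have wb: "w b = x" "w (Suc b) = x" using edge_ends[OF b(3)] that by auto
    have sn: "Suc t < n" if "t < n" "w (Suc t) = x" for t
      using that closed assms(1) by (metis Suc_lessI)
    have "a \<in> {i, j}" "Suc a \<in> {i, j}" "b \<in> {i, j}" "Suc b \<in> {i, j}"
      using v sn that wb b(1) by simp_all
    then show False using b(2) by auto
  qed
  then show s: "w (Suc i) \<noteq> x" "w (i - 1) \<noteq> x" "w (Suc j) \<noteq> x" "w (j - 1) \<noteq> x"
    using i i0 noloop[of "i - 1"] noloop[of "j - 1"] noloop[of i] noloop[of j]
    by (auto intro: less_imp_diff_less)
  then show "Suc i \<noteq> j" "Suc j \<noteq> i" using i by auto
  assume t: "t \<in> {i - 1, i, j - 1, j}"
  then have tn: "t < n" and tx: "w t = x \<or> w (Suc t) = x" using i i0 by auto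
  obtain u where u: "u < n" "u \<noteq> t" "e u = e t" using twice[OF tn] by auto
  have "w u = x \<or> w (Suc u) = x" using edge_ends[OF u(3)] tx by (auto simp: doubleton_eq_iff)
  then show "\<exists>u\<in>{i - 1, i, j - 1, j}. u \<noteq> t \<and> e u = e t" using touch[OF u(1)] u by blast
qed

lemma nonspecial_two_visits:
  assumes "\<not> special x" "w i = x" "w j = x" "i < n" "j < n" "i \<noteq> j"
  shows "visits x = {i, j}"
proof -
  have "card (visits x) = 2" using assms by (simp add: special_def)
  moreover have "{i, j} \<subseteq> visits x" using assms by (auto simp: visits_def)
  moreover have "card {i, j} = 2" using assms by simp
  ultimately show ?thesis using card_subset_eq[of "visits x" "{i, j}"] by simp
qed

text \<open>
  The two edges of the first visit are different and both have to reappear at the second visit, in one of the two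
  orders.
\<close>

lemma nonspecial_edges:
  assumes "\<not> special x" "w i = x" "w j = x" "i < n" "j < n" "i \<noteq> j"
  shows "e (j - 1) = e (i - 1) \<and> e j = e i \<or> e (j - 1) = e i \<and> e j = e (i - 1)"
    and "e (i - 1) \<noteq> e i" "e (j - 1) \<noteq> e j"
proof -
  have x0: "x \<noteq> w 0" using assms by (simp add: special_def)
  note V = nonspecial_two_visits[OF assms]
  note C = corner_cases[OF x0 V assms(6)]
  show ne: "e (i - 1) \<noteq> e i" "e (j - 1) \<noteq> e j" using assms C(1,2) by (auto simp: special_def)
  show "e (j - 1) = e (i - 1) \<and> e j = e i \<or> e (j - 1) = e i \<and> e j = e (i - 1)"
    using C(10)[of "i - 1"] C(10)[of i] C(10)[of "j - 1"] C(10)[of j] ne by (simp; metis)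
qed

text \<open>
  If two strands enter an ordinary vertex by the same step, they leave it by the same step.
\<close>

lemma step_forward:
  assumes "\<not> special (w (Suc i))" "Suc i < n" "Suc j < n" "i \<noteq> j"
    and "w j = w i" "w (Suc j) = w (Suc i)" "sg j = sg i"
  shows "w (Suc (Suc j)) = w (Suc (Suc i))" "sg (Suc j) = sg (Suc i)"
proof -
  have x0: "w (Suc i) \<noteq> w 0" using assms by (simp add: special_def)
  have V: "visits (w (Suc i)) = {Suc i, Suc j}"
    using assms by (intro nonspecial_two_visits) auto
  note C = corner_cases[OF x0 V]
  have "e j = e i" using assms by (simp add: e_def)
  then have "e (Suc j) = e (Suc i)"
    using nonspecial_edges[of "w (Suc i)" "Suc i" "Suc j"] assms by auto
  moreover have "w (Suc (Suc i)) \<noteq> w (Suc i)" "w (Suc (Suc j)) \<noteq> w (Suc i)" using C assms(4) by auto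
  ultimately show "w (Suc (Suc j)) = w (Suc (Suc i))" "sg (Suc j) = sg (Suc i)"
    using assms by (auto simp: e_def split: if_splits)
qed

text \<open>
  The mirror image: here the second strand runs through the vertex in the opposite direction, and the agreement is continued
  forwards along the first strand and backwards along the second.
\<close>

lemma step_backward:
  assumes "\<not> special (w (Suc i))" "Suc i < n" "Suc j < n" "Suc i \<noteq> Suc j"
    and "w (Suc (Suc j)) = w i" "w (Suc j) = w (Suc i)" "sg (Suc j) = (\<not> sg i)"
  shows "w j = w (Suc (Suc i))" "sg j = (\<not> sg (Suc i))"
proof -
  have x0: "w (Suc i) \<noteq> w 0" using assms by (simp add: special_def)
  have V: "visits (w (Suc i)) = {Suc i, Suc j}"
    using assms by (intro nonspecial_two_visits) auto
  note C = corner_cases[OF x0 V]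
  have "e (Suc j) = e i" using assms by (simp add: e_def)
  then have "e j = e (Suc i)"
    using nonspecial_edges[of "w (Suc i)" "Suc i" "Suc j"] assms by auto
  then have "(if sg j then (w j, w (Suc i)) else (w (Suc i), w j)) =
      (if sg (Suc i) then (w (Suc i), w (Suc (Suc i))) else (w (Suc (Suc i)), w (Suc i)))"
    unfolding e_def[of j] e_def[of "Suc i"] assms(6) .
  moreover have "w (Suc (Suc i)) \<noteq> w (Suc i)" "w j \<noteq> w (Suc i)" using C(11,14) assms(4) by simp_all
  ultimately show "w j = w (Suc (Suc i))" "sg j = (\<not> sg (Suc i))"
    by (auto split: if_splits)
qed

definition inner_verts :: "nat set" where
  "inner_verts = w ` {..<n} - {w 0}"

text \<open>
  The special vertices that are neither the base point nor detected by their number of visits: the walk turns back at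
  one of the two visits, and then at both.
\<close>

definition turning :: "nat set" where
  "turning = {x \<in> inner_verts. card (visits x) = 2 \<and> (\<exists>i. 0 < i \<and> i < n \<and> w i = x \<and> e (i - 1) = e i)}"

lemma turning_edges:
  assumes "x \<in> turning"
  obtains a b where "visits x = {a, b}" "a < b" "e (a - 1) = e a" "e (b - 1) = e b"
    "Min (visits x) = a" "Max (visits x) = b" "x \<noteq> w 0"
proof -
  have x0: "x \<noteq> w 0" and "card (visits x) = 2" using assms by (auto simp: turning_def inner_verts_def)
  then obtain a' b' where "visits x = {a', b'}" "a' \<noteq> b'" by (auto simp: card_2_iff)
  moreover define a b where "a = min a' b'" and "b = max a' b'"
  ultimately have V: "visits x = {a, b}" and ab: "a < b"
    by (auto simp: min_def max_def)
  note C = corner_cases[OF x0 V less_imp_neq[OF ab]]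
  obtain i where i: "0 < i" "i < n" "w i = x" "e (i - 1) = e i" using assms by (auto simp: turning_def)
  then have "i \<in> {a, b}" using V by (auto simp: visits_def)
  then have "e (a - 1) = e a \<or> e (b - 1) = e b" using i by auto
  then have "e (a - 1) = e a \<and> e (b - 1) = e b"
    using C(10)[of "a - 1"] C(10)[of a] C(10)[of "b - 1"] C(10)[of b] by (simp; metis)
  moreover have "Min (visits x) = a" "Max (visits x) = b" using V ab by simp_all
  ultimately show thesis using that[OF V ab] x0 by simp
qed

text \<open>
  Each inner vertex \<open>x\<close> owns the steps \<open>P x\<close> along the edge by which it is first visited; different vertices
  have different such edges, since otherwise each would have been visited before the other. At a turning vertex, either all four
  steps around it belong to \<open>P x\<close>, or the second visit uses another edge, whose two steps \<open>Q x\<close> belong to no \<open>P y\<close>. So \<open>x\<close> owns at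
  least two steps, and at least four if it is turning.
\<close>

lemma two_visits_bound: "n \<ge> 2 * card inner_verts + 2 * card turning"
proof -
  define a where "a x = Min (visits x)" for x
  define b where "b x = Max (visits x)" for x
  define P where "P x = {i. i < n \<and> e i = e (a x - 1)}" for x
  define Q where "Q x = (if x \<in> turning \<and> e (b x - 1) \<noteq> e (a x - 1) then {b x - 1, b x} else {})" for x
  have turn: "\<exists>a' b'. visits x = {a', b'} \<and> a' < b' \<and> e (a' - 1) = e a' \<and> e (b' - 1) = e b' \<and>
      a' = a x \<and> b' = b x \<and> x \<noteq> w 0" if "x \<in> turning" for x
    by (rule turning_edges[OF that]) (use that in \<open>auto simp: a_def b_def\<close>)
  have fin: "finite inner_verts" by (simp add: inner_verts_def)
  have a: "0 < a x" "a x < n" "w (a x) = x" if "x \<in> inner_verts" for x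
  proof -
    have "visits x \<noteq> {}" using that by (auto simp: inner_verts_def visits_def)
    then have "a x \<in> visits x" unfolding a_def by (intro Min_in) auto
    then show "a x < n" "w (a x) = x" by (auto simp: visits_def)
    then show "0 < a x" using that by (auto simp: inner_verts_def intro!: Nat.gr0I)
  qed
  have a_le: "a x \<le> i" if "i < n" "w i = x" for x i
    unfolding a_def using that by (intro Min_le) (auto simp: visits_def)
  have ti: "x \<in> inner_verts" if "x \<in> turning" for x using that by (simp add: turning_def)
  have PP: "P x \<inter> P y = {}" if "x \<in> inner_verts" "y \<in> inner_verts" "x \<noteq> y" for x y
  proof (rule ccontr)
    assume "P x \<inter> P y \<noteq> {}"
    then have "e (a x - 1) = e (a y - 1)" by (auto simp: P_def)
    from edge_ends[OF this] have "{w (a x - 1), x} = {w (a y - 1), y}" using a that by simp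
    then have "w (a x - 1) = y" "w (a y - 1) = x" using that(3) by (auto simp: doubleton_eq_iff)
    then have "a y \<le> a x - 1" "a x \<le> a y - 1" using a that by (auto intro!: a_le less_imp_diff_less)
    then show False using a(1)[OF that(1)] by linarith
  qed
  have Q: "Q x \<subseteq> {..<n}" "Q x \<noteq> {} \<Longrightarrow> x \<in> turning" for x
  proof -
    show "Q x \<noteq> {} \<Longrightarrow> x \<in> turning" by (auto simp: Q_def)
    show "Q x \<subseteq> {..<n}"
    proof (cases "x \<in> turning")
      case True
      then obtain a' b' where "visits x = {a', b'}" "b x = b'" using turn[OF True] by blast
      then have "b x \<in> visits x" by simp
      then show ?thesis by (auto simp: Q_def visits_def)
    qed (simp add: Q_def)
  qed
  have QP: "Q x \<inter> P y = {}" if "y \<in> inner_verts" for x y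
  proof (rule ccontr)
    assume "Q x \<inter> P y \<noteq> {}"
    then obtain i where i: "i \<in> Q x" "i \<in> P y" by auto
    then have x: "x \<in> turning" "e (b x - 1) \<noteq> e (a x - 1)" by (auto simp: Q_def split: if_splits)
    obtain a' b' where V: "visits x = {a', b'}" "a' < b'" "e (a' - 1) = e a'" "e (b' - 1) = e b'"
      "a' = a x" "b' = b x" "x \<noteq> w 0"
      using turn[OF \<open>x \<in> turning\<close>] by blast
    note C = corner_cases[OF V(7) V(1) less_imp_neq[OF V(2)]]
    have "e i = e b'" using i(1) x V by (auto simp: Q_def)
    then have ey: "e (a y - 1) = e b'" using i(2) by (simp add: P_def)
    have "a y - 1 \<in> {a' - 1, a', b' - 1, b'}"
    proof (rule C(7))
      show "a y - 1 < n" using a[OF that] by simp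
      show "w (a y - 1) = x \<or> w (Suc (a y - 1)) = x" using edge_ends[OF ey] C(6) by (auto simp: doubleton_eq_iff)
    qed
    moreover have "e (a y - 1) \<noteq> e a'" "e (a y - 1) \<noteq> e (a' - 1)" using ey x V by auto
    ultimately consider "a y - 1 = b' - 1" | "a y - 1 = b'" by auto
    then show False
    proof cases
      case 1
      then have "a y = b'" using a(1)[OF that] C(2) by linarith
      then have "y = x" using a(3)[OF that] C(6) by simp
      then show False using \<open>a y = b'\<close> V by simp
    next
      case 2
      then have ay: "a y = Suc b'" using a(1)[OF that] by linarith
      then have "w (Suc b') = y" using a(3)[OF that] by simp
      moreover have "{w (b' - 1), x} = {x, w (Suc b')}" using edge_ends[OF V(4)] C(2,6) by simp
      ultimately have "w (b' - 1) = y" by (auto simp: doubleton_eq_iff)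
      then have "a y \<le> b' - 1" using C(4) by (intro a_le) auto
      then show False using ay by simp
    qed
  qed
  have QQ': False if "x \<in> turning" "y \<in> turning" "e (b x - 1) \<noteq> e (a x - 1)" "b y = Suc (b x)" for x y
  proof -
    obtain a' b' where V: "visits x = {a', b'}" "a' < b'" "e (a' - 1) = e a'" "e (b' - 1) = e b'"
      "a' = a x" "b' = b x" "x \<noteq> w 0"
      using turn[OF \<open>x \<in> turning\<close>] by blast
    note C = corner_cases[OF V(7) V(1) less_imp_neq[OF V(2)]]
    obtain a'' b'' where W: "visits y = {a'', b''}" "b'' = b y" "e (b'' - 1) = e b''"
      using turn[OF \<open>y \<in> turning\<close>] by blast
    have "b'' < n" using W by (auto simp: visits_def)
    then have n: "Suc b' < n" using W V that by simp
    have "e (Suc b') = e b'" using W V that by simp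
    from edge_ends[OF this] have "w (Suc b') = x \<or> w (Suc (Suc b')) = x"
      using C(6) by (auto simp: doubleton_eq_iff)
    then have "Suc b' \<in> {a' - 1, a', b' - 1, b'}" using C(7) n by blast
    then show False using V(2) by auto
  qed
  have QQ: "Q x \<inter> Q y = {}" if "x \<noteq> y" for x y
  proof (rule ccontr)
    assume "Q x \<inter> Q y \<noteq> {}"
    then obtain i where i: "i \<in> Q x" "i \<in> Q y" by auto
    then have xy: "x \<in> turning" "y \<in> turning" "e (b x - 1) \<noteq> e (a x - 1)" "e (b y - 1) \<noteq> e (a y - 1)"
      by (auto simp: Q_def split: if_splits)
    have bx: "w (b x) = x" "0 < b x" if "x \<in> turning" for x
    proof -
      obtain a' b' where V: "visits x = {a', b'}" "b' = b x" "a' < b'"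
        using turn[OF \<open>x \<in> turning\<close>] by blast
      then show "w (b x) = x" "0 < b x" by (auto simp: visits_def)
    qed
    have "b x \<noteq> b y" using bx(1)[OF xy(1)] bx(1)[OF xy(2)] that by auto
    moreover have "i \<in> {b x - 1, b x}" "i \<in> {b y - 1, b y}" using i by (auto simp: Q_def split: if_splits)
    ultimately have "b y = Suc (b x) \<or> b x = Suc (b y)" using bx(2) xy by auto
    then show False using QQ' xy by blast
  qed
  have card2: "card (P x) \<ge> 2" if "x \<in> inner_verts" for x
  proof -
    have ax: "a x - 1 < n" using a(2)[OF that] by simp
    obtain j where j: "j < n" "j \<noteq> a x - 1" "e j = e (a x - 1)" using twice[OF ax] by auto
    have "card {j, a x - 1} \<le> card (P x)" using j ax by (intro card_mono) (auto simp: P_def)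
    then show ?thesis using j by simp
  qed
  have card4: "card (P x \<union> Q x) \<ge> 4" if "x \<in> turning" for x
  proof -
    obtain a' b' where V: "visits x = {a', b'}" "a' < b'" "e (a' - 1) = e a'" "e (b' - 1) = e b'"
      "a' = a x" "b' = b x" "x \<noteq> w 0"
      using turn[OF \<open>x \<in> turning\<close>] by blast
    note C = corner_cases[OF V(7) V(1) less_imp_neq[OF V(2)]]
    have "a' < b' - 1" using V(2) C(8) by linarith
    then have "distinct [a' - 1, a', b' - 1, b']" using C(1) by auto
    from distinct_card[OF this] have "card {a' - 1, a', b' - 1, b'} = 4" by simp
    moreover have "{a' - 1, a', b' - 1, b'} \<subseteq> P x \<union> Q x"
      using V C(1,2,3,4) that by (auto simp: P_def Q_def)
    moreover have "finite (P x \<union> Q x)" by (simp add: P_def Q_def)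
    ultimately show ?thesis by (metis card_mono)
  qed
  have "2 * card inner_verts + 2 * card turning = (\<Sum>x\<in>inner_verts. 2 + (if x \<in> turning then 2 else 0))"
  proof -
    have "(\<Sum>x\<in>inner_verts. if x \<in> turning then 2 else (0::nat)) = (\<Sum>x\<in>turning. 2)"
      using fin by (intro sum.mono_neutral_cong_right) (auto simp: turning_def)
    then show ?thesis by (simp only: sum.distrib) simp
  qed
  also have "\<dots> \<le> (\<Sum>x\<in>inner_verts. card (P x \<union> Q x))"
  proof (rule sum_mono)
    fix x assume x: "x \<in> inner_verts"
    have "card (P x) \<le> card (P x \<union> Q x)" by (intro card_mono) (auto simp: P_def Q_def)
    then show "2 + (if x \<in> turning then 2 else 0) \<le> card (P x \<union> Q x)"
      using card2[OF x] card4[of x] by auto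
  qed
  also have "\<dots> = card (\<Union>x\<in>inner_verts. P x \<union> Q x)"
  proof (rule card_UN_disjoint[symmetric])
    show "\<forall>i\<in>inner_verts. \<forall>j\<in>inner_verts. i \<noteq> j \<longrightarrow> (P i \<union> Q i) \<inter> (P j \<union> Q j) = {}"
      using PP QP QQ by blast
  qed (auto simp: fin P_def Q_def)
  also have "\<dots> \<le> card {..<n}" using Q by (intro card_mono) (auto simp: P_def)
  finally show ?thesis by simp
qed

text \<open>
  With \<open>c x\<close> visits to \<open>x\<close>, the sum of \<open>c x - 2\<close> over the inner vertices is at most \<open>2 r\<close>, and a vertex with \<open>c x \<ge> 3\<close> has
  \<open>c x \<le> 3 (c x - 2)\<close>. Turning vertices are covered by \<open>two_visits_bound\<close>, which leaves room for at most \<open>r\<close> of them.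
\<close>

lemma special_bound:
  assumes "n + 2 \<le> 2 * card (w ` {..n}) + 2 * r"
  shows "card {i. i < n \<and> special (w i)} \<le> 8 * r"
proof (cases "n = 0")
  case False
  define c where "c x = int (card (visits x))" for x
  have W: "w ` {..<n} = insert (w 0) inner_verts" using False by (auto simp: inner_verts_def)
  have Wn: "w ` {..n} = w ` {..<n}"
  proof -
    have "{..n} = insert n {..<n}" by auto
    moreover have "w n \<in> w ` {..<n}" using closed False by simp
    ultimately show ?thesis by (simp add: insert_absorb)
  qed
  have fin: "finite inner_verts" "w 0 \<notin> inner_verts" by (auto simp: inner_verts_def)
  have cardV: "card (w ` {..n}) = Suc (card inner_verts)" unfolding Wn W using fin by simp
  have card_by: "card {i. i < n \<and> R (w i)} = (\<Sum>x\<in>insert (w 0) inner_verts. if R x then card (visits x) else 0)" for R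
  proof -
    have "{i. i < n \<and> R (w i)} = (\<Union>x\<in>{x\<in>insert (w 0) inner_verts. R x}. visits x)"
      using W by (auto simp: visits_def)
    also have "card \<dots> = (\<Sum>x\<in>{x\<in>insert (w 0) inner_verts. R x}. card (visits x))"
      using fin by (intro card_UN_disjoint) (auto simp: visits_def)
    also have "\<dots> = (\<Sum>x\<in>insert (w 0) inner_verts. if R x then card (visits x) else 0)"
      using fin by (intro sum.inter_filter) auto
    finally show ?thesis .
  qed
  have n: "int n = c (w 0) + (\<Sum>x\<in>inner_verts. c x)"
    using arg_cong[OF card_by[of "\<lambda>_. True"], of int] fin by (simp add: c_def)
  have p: "int (card {i. i < n \<and> special (w i)}) = c (w 0) + (\<Sum>x\<in>inner_verts. if special x then c x else 0)"
    using card_by[of special] fin by (simp add: c_def special_def if_distrib[of int] cong: if_cong)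
  have "(if special x then c x else 0) \<le> 3 * (c x - 2) + (if x \<in> turning then 2 else 0)" if x: "x \<in> inner_verts" for x
  proof -
    obtain i where i: "i < n" "w i = x" "x \<noteq> w 0" using x by (auto simp: inner_verts_def)
    then have "0 < i" by (auto intro!: Nat.gr0I)
    then obtain j where j: "j < n" "j \<noteq> i" "w j = x" using revisit[of i] i by auto
    have "card {i, j} \<le> card (visits x)" using i j by (intro card_mono) (auto simp: visits_def)
    then have c2: "c x \<ge> 2" using j by (simp add: c_def)
    show ?thesis
    proof (cases "c x = 2")
      case True
      then have "special x \<longleftrightarrow> x \<in> turning" using i x by (auto simp: c_def special_def turning_def)
      then show ?thesis using True by simp
    qed (use c2 in auto)
  qed
  then have "(\<Sum>x\<in>inner_verts. if special x then c x else 0) \<le>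
      (\<Sum>x\<in>inner_verts. 3 * (c x - 2) + (if x \<in> turning then 2 else 0))"
    by (rule sum_mono)
  also have "\<dots> = 3 * (\<Sum>x\<in>inner_verts. c x) - 6 * int (card inner_verts) + 2 * int (card turning)"
  proof -
    have "(\<Sum>x\<in>inner_verts. if x \<in> turning then 2 else (0::int)) = (\<Sum>x\<in>turning. 2)"
      using fin by (intro sum.mono_neutral_cong_right) (auto simp: turning_def)
    then show ?thesis by (simp add: sum.distrib sum_subtractf sum_distrib_left algebra_simps)
  qed
  finally have "int (card {i. i < n \<and> special (w i)}) \<le>
      3 * int n - 2 * c (w 0) - 6 * int (card inner_verts) + 2 * int (card turning)"
    using n p by simp
  moreover have "c (w 0) \<ge> 0" by (simp add: c_def)
  moreover have "int n \<le> 2 * int (card inner_verts) + 2 * int r" using assms cardV by simp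
  moreover have "2 * int (card inner_verts) + 2 * int (card turning) \<le> int n" using two_visits_bound by linarith
  ultimately show ?thesis by linarith
qed simp

end

section \<open>Cutting a reduced walk into segments\<close>

context reduced_walk
begin

definition special_corners :: "nat set" where
  "special_corners = {i. i < n \<and> special (w i)}"

definition num_segs :: nat where
  "num_segs = card special_corners"

text \<open>
  The corners at special vertices in increasing order. The final corner, a copy of corner \<open>0\<close>, is appended, so that segment \<open>j\<close> runs
  from \<open>cut j\<close> to \<open>cut (Suc j)\<close> and \<open>num_segs\<close> is the number of segments.
\<close>

definition cut :: "nat \<Rightarrow> nat" where
  "cut j = (sorted_list_of_set special_corners @ [n]) ! j"

lemma finite_special_corners: "finite special_corners"
  by (simp add: special_corners_def)

lemma special_0: "special (w 0)"
  by (simp add: special_def)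

lemma cut_num_segs: "cut num_segs = n"
  by (simp add: cut_def num_segs_def nth_append)

lemma cut_special: "j < num_segs \<Longrightarrow> cut j \<in> special_corners"
  using nth_mem[of j "sorted_list_of_set special_corners"]
  by (simp add: cut_def num_segs_def nth_append finite_special_corners)

lemma cut_le_n: "j \<le> num_segs \<Longrightarrow> cut j \<le> n"
  using cut_special[of j] cut_num_segs by (cases "j = num_segs") (auto simp: special_corners_def)

lemma special_cut: "j \<le> num_segs \<Longrightarrow> special (w (cut j))"
  using cut_special[of j] cut_num_segs closed special_0
  by (cases "j = num_segs") (auto simp: special_corners_def)

lemma cut_less: assumes "i < j" "j \<le> num_segs" shows "cut i < cut j"
proof (cases "j = num_segs")
  case True
  then show ?thesis using cut_special[of i] assms by (simp add: cut_num_segs special_corners_def)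
next
  case False
  then show ?thesis
    using assms sorted_wrt_nth_less[OF strict_sorted_list_of_set, of i j special_corners]
    by (simp add: cut_def num_segs_def nth_append)
qed

lemma cut_surj: assumes "i \<le> n" "special (w i)" shows "\<exists>j\<le>num_segs. cut j = i"
proof (cases "i = n")
  case True
  then show ?thesis using cut_num_segs by auto
next
  case False
  then have "i \<in> set (sorted_list_of_set special_corners)"
    using assms by (simp add: finite_special_corners) (simp add: special_corners_def)
  then obtain j where "j < num_segs" "sorted_list_of_set special_corners ! j = i"
    by (auto simp: in_set_conv_nth num_segs_def)
  then show ?thesis by (intro exI[of _ j]) (simp add: cut_def nth_append num_segs_def)
qed

lemma cut_0: "cut 0 = 0"
proof -
  obtain j where "j \<le> num_segs" "cut j = 0" using cut_surj[of 0] special_0 by auto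
  then show ?thesis using cut_less[of 0 j] by (cases "j = 0") auto
qed

lemma corner_in_segment:
  assumes "i \<le> n"
  shows "(\<exists>j\<le>num_segs. i = cut j) \<or> (\<exists>j<num_segs. cut j < i \<and> i < cut (Suc j))"
proof -
  define j where "j = Max {j. j \<le> num_segs \<and> cut j \<le> i}"
  have fin: "finite {j. j \<le> num_segs \<and> cut j \<le> i}" by simp
  have "0 \<in> {j. j \<le> num_segs \<and> cut j \<le> i}" by (simp add: cut_0)
  then have "j \<in> {j. j \<le> num_segs \<and> cut j \<le> i}" unfolding j_def using fin by (intro Max_in) auto
  then have j: "j \<le> num_segs" "cut j \<le> i" by auto
  show ?thesis
  proof (cases "j = num_segs \<or> cut j = i")
    case True
    then show ?thesis using j assms cut_num_segs by auto
  next
    case False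
    then have "j < num_segs" using j by simp
    have "i < cut (Suc j)"
    proof (rule ccontr)
      assume "\<not> i < cut (Suc j)"
      then have "Suc j \<le> j" unfolding j_def using fin \<open>j < num_segs\<close> j_def by (intro Max_ge) auto
      then show False by simp
    qed
    then show ?thesis using False j \<open>j < num_segs\<close> by auto
  qed
qed

lemma segment_disjoint:
  assumes "i < num_segs" "j < num_segs" "cut i < a" "a < cut (Suc i)" "cut j < a" "a < cut (Suc j)"
  shows "i = j"
proof (rule ccontr)
  assume "i \<noteq> j"
  then consider "Suc i \<le> j" | "Suc j \<le> i" by linarith
  then show False
  proof cases
    case 1
    then have "cut (Suc i) \<le> cut j" using cut_less[of "Suc i" j] assms by (cases "Suc i = j") auto
    then show False using assms by simp
  next
    case 2
    then have "cut (Suc j) \<le> cut i" using cut_less[of "Suc j" i] assms by (cases "Suc j = i") auto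
    then show False using assms by simp
  qed
qed

lemma inner_nonspecial:
  assumes "j < num_segs" "cut j < i" "i < cut (Suc j)"
  shows "\<not> special (w i)" "i < n"
proof -
  show "i < n" using assms cut_le_n[of "Suc j"] by simp
  show "\<not> special (w i)"
  proof
    assume "special (w i)"
    then obtain j' where j': "j' \<le> num_segs" "cut j' = i" using cut_surj[of i] \<open>i < n\<close> by auto
    consider "j' \<le> j" | "Suc j \<le> j'" by linarith
    then show False
    proof cases
      case 1
      then have "cut j' \<le> cut j" using cut_less[of j' j] assms by (cases "j' = j") auto
      then show False using assms j' by simp
    next
      case 2
      then have "cut (Suc j) \<le> cut j'" using cut_less[of "Suc j" j'] j' by (cases "j' = Suc j") auto
      then show False using assms j' by simp
    qed
  qed
qed

definition seg :: "nat \<Rightarrow> nat list \<times> bool list" where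
  "seg j = (map w [cut j..<Suc (cut (Suc j))], map sg [cut j..<cut (Suc j)])"

definition reverse_seg :: "nat list \<times> bool list \<Rightarrow> nat list \<times> bool list" where
  "reverse_seg u = (rev (fst u), flip_rev (snd u))"

lemma reverse_seg_reverse_seg [simp]: "reverse_seg (reverse_seg u) = u"
  by (simp add: reverse_seg_def)

text \<open>
  If the first step of a segment is repeated elsewhere, the two strands stay together until they reach a special vertex, and they reach it
  at the same time.
\<close>

lemma seg_mate_forward:
  assumes j: "j < num_segs" and s': "s' < n" "s' \<noteq> cut j"
    and start: "w s' = w (cut j)" "w (Suc s') = w (Suc (cut j))" "sg s' = sg (cut j)"
  shows "\<exists>j'<num_segs. j' \<noteq> j \<and> seg j' = seg j"
proof -
  define s where "s = cut j"
  have "special (w s')" using special_cut[of j] j start by simp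
  then obtain j' where j': "j' \<le> num_segs" "cut j' = s'" using cut_surj[of s'] s' by auto
  then have j'lt: "j' < num_segs" using s' cut_num_segs by (cases "j' = num_segs") auto
  define l where "l = cut (Suc j) - s"
  define l' where "l' = cut (Suc j') - s'"
  have sl: "s + l = cut (Suc j)" "l > 0" using cut_less[of j "Suc j"] j by (auto simp: l_def s_def)
  have sl': "s' + l' = cut (Suc j')" "l' > 0" using cut_less[of j' "Suc j'"] j'lt j' by (auto simp: l'_def)
  have inn: "\<not> special (w (s + i))" "s + i < n" if "0 < i" "i < l" for i
    using inner_nonspecial[OF j, of "s + i"] that sl by (auto simp: s_def)
  have inn': "\<not> special (w (s' + i))" "s' + i < n" if "0 < i" "i < l'" for i
    using inner_nonspecial[OF j'lt, of "s' + i"] that sl' j' by auto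
  have walk: "w (s' + i) = w (s + i) \<and> w (s' + Suc i) = w (s + Suc i) \<and> sg (s' + i) = sg (s + i)"
    if "i < l" "i < l'" for i
    using that
  proof (induction i)
    case 0
    then show ?case using start by (simp add: s_def)
  next
    case (Suc i)
    then have IH: "w (s' + i) = w (s + i)" "w (s' + Suc i) = w (s + Suc i)" "sg (s' + i) = sg (s + i)" by auto
    show ?case
      using step_forward[of "s + i" "s' + i"] inn[of "Suc i"] inn'[of "Suc i"] Suc.prems IH s'
      by (simp add: s_def)
  qed
  have "l = l'"
  proof (rule ccontr)
    assume "l \<noteq> l'"
    then consider "l < l'" | "l' < l" by linarith
    then show False
    proof cases
      case 1
      then have "w (s' + l) = w (s + l)" using walk[of "l - 1"] sl(2) by auto
      then show False using inn'[of l] 1 sl special_cut[of "Suc j"] j by simp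
    next
      case 2
      then have "w (s' + l') = w (s + l')" using walk[of "l' - 1"] sl'(2) by auto
      then show False using inn[of l'] 2 sl' special_cut[of "Suc j'"] j'lt by simp
    qed
  qed
  have "seg j' = seg j"
    unfolding seg_def j'(2) s_def[symmetric] sl(1)[symmetric] sl'(1)[symmetric] \<open>l = l'\<close>[symmetric]
  proof (intro prod_eqI; simp only: fst_conv snd_conv; intro nth_equalityI)
    fix i assume "i < length (map w [s'..<Suc (s' + l)])"
    then have "i \<le> l" by simp
    then have "w (s' + i) = w (s + i)"
      using walk[of i] walk[of "i - 1"] sl(2) \<open>l = l'\<close> by (cases "i = l") auto
    then show "map w [s'..<Suc (s' + l)] ! i = map w [s..<Suc (s + l)] ! i"
      using \<open>i \<le> l\<close> by (simp del: upt_Suc)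
  next
    fix i assume "i < length (map sg [s'..<s' + l])"
    then show "map sg [s'..<s' + l] ! i = map sg [s..<s + l] ! i"
      using walk[of i] \<open>l = l'\<close> by simp
  qed (simp_all del: upt_Suc)
  moreover have "j' \<noteq> j" using j' s' by auto
  ultimately show ?thesis using j'lt by blast
qed

text \<open>
  If the first step of a segment is reversed elsewhere, the second strand is followed backwards. The two strands cannot
  meet each other: they would meet either at a corner, where the walk would turn back, or in
  the middle of a step that is its own reversal. This excludes in particular that a segment is its own reversal.
\<close>

lemma seg_mate_backward:
  assumes j: "j < num_segs" and s': "s' < n" "s' \<noteq> cut j"
    and start: "w (Suc s') = w (cut j)" "w s' = w (Suc (cut j))" "sg s' = (\<not> sg (cut j))"
  shows "\<exists>j'<num_segs. j' \<noteq> j \<and> seg j' = reverse_seg (seg j)"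
proof -
  define s where "s = cut j"
  define f where "f = Suc s'"
  have "special (w f)" using special_cut[of j] j start by (simp add: f_def)
  then obtain k' where k': "k' \<le> num_segs" "cut k' = f" using cut_surj[of f] s' by (auto simp: f_def)
  then have "k' \<noteq> 0" using cut_0 by (auto simp: f_def intro: Nat.gr0I)
  then obtain j' where j': "k' = Suc j'" by (cases k') auto
  have j'lt: "j' < num_segs" "cut (Suc j') = f" using k' j' by auto
  define l where "l = cut (Suc j) - s"
  define l' where "l' = f - cut j'"
  have sl: "s + l = cut (Suc j)" "l > 0" using cut_less[of j "Suc j"] j by (auto simp: l_def s_def)
  have sl': "f - l' = cut j'" "l' > 0" "l' \<le> f" using cut_less[of j' "Suc j'"] j'lt by (auto simp: l'_def)
  have inn: "\<not> special (w (s + i))" "s + i < n" if "0 < i" "i < l" for i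
    using inner_nonspecial[OF j, of "s + i"] that sl by (auto simp: s_def)
  have inn': "\<not> special (w (f - i))" "f - i < n" if "0 < i" "i < l'" for i
    using inner_nonspecial[OF j'lt(1), of "f - i"] that sl' j'lt by auto
  \<comment> \<open>If the strands met at corner \<open>s + i\<close>, the steps before and after it would be mutually reverse.\<close>
  have turn: "f - i \<noteq> s + i" if "0 < i" "i < l" "w (f - Suc (i - 1)) = w (s + Suc (i - 1))"
    "sg (f - Suc (i - 1)) = (\<not> sg (s + (i - 1)))" "w (f - (i - 1)) = w (s + (i - 1))" "i \<le> f" for i
  proof
    assume eq: "f - i = s + i"
    define c where "c = s + i"
    have c: "0 < c" "c < n" "\<not> special (w c)" using inn that by (auto simp: c_def)
    have "f - (i - 1) = Suc c" "s + (i - 1) = c - 1" "f - Suc (i - 1) = c"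
      using eq that by (auto simp: c_def)
    then have "w (Suc c) = w (c - 1)" "sg c = (\<not> sg (c - 1))" using that by auto
    then have "e (c - 1) = e c" using c by (simp add: e_def)
    then show False using c by (auto simp: special_def)
  qed
  have walk: "w (f - i) = w (s + i) \<and> w (f - Suc i) = w (s + Suc i) \<and> sg (f - Suc i) = (\<not> sg (s + i))"
    if "i < l" "i < l'" for i
    using that
  proof (induction i)
    case 0
    then show ?case using start by (simp add: s_def f_def)
  next
    case (Suc i)
    then have IH: "w (f - i) = w (s + i)" "w (f - Suc i) = w (s + Suc i)" "sg (f - Suc i) = (\<not> sg (s + i))" by auto
    define b where "b = f - Suc (Suc i)"
    have b: "f - Suc i = Suc b" "f - i = Suc (Suc b)" using Suc.prems sl' by (auto simp: b_def)
    have "s + Suc i \<noteq> Suc b"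
      using turn[of "Suc i"] Suc.prems IH b sl' by auto
    then show ?case
      using step_backward[of "s + i" b] inn[of "Suc i"] inn'[of "Suc i"] Suc.prems IH s' b
      unfolding b_def[symmetric] b by simp
  qed
  have "l = l'"
  proof (rule ccontr)
    assume "l \<noteq> l'"
    then consider "l < l'" | "l' < l" by linarith
    then show False
    proof cases
      case 1
      then have "w (f - l) = w (s + l)" using walk[of "l - 1"] sl(2) by auto
      then show False using inn'[of l] 1 sl special_cut[of "Suc j"] j by simp
    next
      case 2
      then have "w (f - l') = w (s + l')" using walk[of "l' - 1"] sl'(2) by auto
      then show False using inn[of l'] 2 sl' special_cut[of "j'"] j'lt by simp
    qed
  qed
  have "seg j' = reverse_seg (seg j)"
    unfolding seg_def reverse_seg_def flip_rev_def j'lt(2) s_def[symmetric] sl(1)[symmetric] sl'(1)[symmetric] \<open>l = l'\<close>[symmetric]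
  proof (intro prod_eqI; simp only: fst_conv snd_conv; intro nth_equalityI)
    fix i assume "i < length (map w [f - l..<Suc f])"
    then have i: "i \<le> l" using sl'(3) \<open>l = l'\<close> by (simp del: upt_Suc)
    have "w (f - (l - i)) = w (s + (l - i))"
      using walk[of "l - i"] walk[of "l - 1"] sl(2) \<open>l = l'\<close> by (cases "i = 0") auto
    moreover have "f - (l - i) = f - l + i" using i sl' \<open>l = l'\<close> by auto
    ultimately show "map w [f - l..<Suc f] ! i = rev (map w [s..<Suc (s + l)]) ! i"
      using i sl' \<open>l = l'\<close> by (simp add: rev_nth del: upt_Suc)
  next
    fix i assume "i < length (map sg [f - l..<f])"
    then have i: "i < l" using sl' \<open>l = l'\<close> by simp
    have "sg (f - Suc (l - Suc i)) = (\<not> sg (s + (l - Suc i)))"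
      using walk[of "l - Suc i"] i \<open>l = l'\<close> by simp
    moreover have "f - Suc (l - Suc i) = f - l + i" using i sl' \<open>l = l'\<close> by auto
    ultimately show "map sg [f - l..<f] ! i = rev (map Not (map sg [s..<s + l])) ! i"
      using i sl' \<open>l = l'\<close> by (simp add: rev_nth)
  qed (use sl' \<open>l = l'\<close> in \<open>simp_all del: upt_Suc\<close>)
  moreover have "j' \<noteq> j"
  proof
    assume "j' = j"
    then have fs: "f = s + l" using j'lt sl by simp
    show False
    proof (cases "even l")
      case True
      then obtain h where h: "l = 2 * h" by blast
      then have "f - h = s + h" "0 < h" "h < l" using fs sl(2) by auto
      then show False using turn[of h] walk[of "h - 1"] \<open>l = l'\<close> sl' fs by auto
    next
      case False
      then obtain h where h: "l = 2 * h + 1" by (blast elim: oddE)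
      then have "sg (f - Suc h) = (\<not> sg (s + h))" using walk[of h] \<open>l = l'\<close> by simp
      moreover have "f - Suc h = s + h" using fs h by simp
      ultimately show False by simp
    qed
  qed
  ultimately show ?thesis using j'lt by blast
qed

lemma seg_mate:
  assumes "j < num_segs"
  shows "\<exists>j'<num_segs. j' \<noteq> j \<and> (seg j' = seg j \<or> seg j' = reverse_seg (seg j))"
proof -
  have "cut j < n" using cut_special[OF assms] by (simp add: special_corners_def)
  then obtain s' where s': "s' < n" "s' \<noteq> cut j" "e s' = e (cut j)" using twice by blast
  show ?thesis
  proof (cases "sg s' = sg (cut j)")
    case True
    then have "w s' = w (cut j)" "w (Suc s') = w (Suc (cut j))"
      using s'(3) by (auto simp: e_def split: if_splits)
    then show ?thesis using seg_mate_forward[OF assms s'(1,2) _ _ True] by blast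
  next
    case False
    then have "w (Suc s') = w (cut j)" "w s' = w (Suc (cut j))" "sg s' = (\<not> sg (cut j))"
      using s'(3) by (auto simp: e_def split: if_splits)
    then show ?thesis using seg_mate_backward[OF assms s'(1,2)] by blast
  qed
qed

end

section \<open>Describing a reduced walk by its segments\<close>

definition orient :: "bool \<Rightarrow> bool list \<Rightarrow> bool list" where
  "orient d s = (if d then s else flip_rev s)"

text \<open>
  The corner at which segment \<open>j\<close> starts, recovered from the sign words \<open>\<beta>\<close> of the representatives \<open>c i\<close> of all segments.
\<close>

definition start :: "(nat \<Rightarrow> nat) \<Rightarrow> (nat \<Rightarrow> bool list) \<Rightarrow> nat \<Rightarrow> nat" where
  "start c \<beta> j = (\<Sum>i<j. length (\<beta> (c i)))"

text \<open>
  The position within the representative \<open>c j\<close> that corresponds to position \<open>a\<close> of segment \<open>j\<close>.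
\<close>

definition offset :: "(nat \<Rightarrow> nat) \<Rightarrow> (nat \<Rightarrow> bool) \<Rightarrow> (nat \<Rightarrow> bool list) \<Rightarrow> nat \<Rightarrow> nat \<Rightarrow> nat" where
  "offset c dir \<beta> j a = (if dir j then a else length (\<beta> (c j)) - a)"

text \<open>
  The corners \<open>0, ..., n\<close> of the walk \<open>w\<close> are the starts of segments (with the end of the last one as start \<open>p\<close>) and inner
  positions of segments. Two starts are the same vertex iff \<open>lab\<close> agrees; starts and inner positions
  are never the same vertex; an inner position is the same vertex as the corresponding one in the representative, and inner
  positions that are the same vertex correspond to the same position of the same representative. So the description determines which corners coincide.
\<close>

definition described_by ::
  "nat \<Rightarrow> (nat \<Rightarrow> nat) \<Rightarrow> nat \<Rightarrow> (nat \<Rightarrow> nat) \<Rightarrow> (nat \<Rightarrow> bool) \<Rightarrow> (nat \<Rightarrow> nat) \<Rightarrow> (nat \<Rightarrow> bool list) \<Rightarrow> bool" where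
  "described_by n w p c dir lab \<beta> \<longleftrightarrow>
     (\<forall>i\<le>n. (\<exists>j\<le>p. i = start c \<beta> j) \<or>
            (\<exists>j<p. \<exists>a. 0 < a \<and> a < length (\<beta> (c j)) \<and> i = start c \<beta> j + a)) \<and>
     (\<forall>j\<le>p. \<forall>j'\<le>p. w (start c \<beta> j) = w (start c \<beta> j') \<longleftrightarrow> lab j = lab j') \<and>
     (\<forall>j<p. \<forall>a. 0 < a \<and> a < length (\<beta> (c j)) \<longrightarrow>
        (\<forall>j'\<le>p. w (start c \<beta> j + a) \<noteq> w (start c \<beta> j')) \<and>
        w (start c \<beta> j + a) = w (start c \<beta> (c j) + offset c dir \<beta> j a)) \<and>
     (\<forall>j<p. \<forall>a. 0 < a \<and> a < length (\<beta> (c j)) \<longrightarrow> (\<forall>j'<p. \<forall>a'. 0 < a' \<and> a' < length (\<beta> (c j')) \<longrightarrow>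
        w (start c \<beta> j + a) = w (start c \<beta> j' + a') \<longrightarrow> c j = c j' \<and> offset c dir \<beta> j a = offset c dir \<beta> j' a'))"

lemma described_by_same_partition:
  assumes "described_by n w p c dir lab \<beta>" "described_by n w' p c dir lab \<beta>"
    and "i \<le> n" "i' \<le> n" "w i = w i'"
  shows "w' i = w' i'"
proof -
  let ?t = "start c \<beta>"
  let ?inner = "\<lambda>i. \<exists>j<p. \<exists>a. 0 < a \<and> a < length (\<beta> (c j)) \<and> i = ?t j + a"
  note D = assms(1)[unfolded described_by_def] and D' = assms(2)[unfolded described_by_def]
  note cov = D[THEN conjunct1, rule_format]
  note lab = D[THEN conjunct2, THEN conjunct1, rule_format]
    and lab' = D'[THEN conjunct2, THEN conjunct1, rule_format]
  note inn = D[THEN conjunct2, THEN conjunct2, THEN conjunct1, rule_format]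
    and inn' = D'[THEN conjunct2, THEN conjunct2, THEN conjunct1, rule_format]
  note uniq = D[THEN conjunct2, THEN conjunct2, THEN conjunct2, rule_format]
  consider (cut) j j' where "j \<le> p" "j' \<le> p" "i = ?t j" "i' = ?t j'"
    | (inner) j a j' a' where "j < p" "0 < a \<and> a < length (\<beta> (c j))" "i = ?t j + a"
        "j' < p" "0 < a' \<and> a' < length (\<beta> (c j'))" "i' = ?t j' + a'"
    | (mixed) j j' a' where "j \<le> p" "i = ?t j" "j' < p" "0 < a' \<and> a' < length (\<beta> (c j'))" "i' = ?t j' + a'"
    | (mixed') j a j' where "j < p" "0 < a \<and> a < length (\<beta> (c j))" "i = ?t j + a" "j' \<le> p" "i' = ?t j'"
    using cov[OF assms(3)] cov[OF assms(4)] by (elim disjE exE conjE) auto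
  then show ?thesis
  proof cases
    case cut
    then have "lab j = lab j'" using lab[of j j'] assms(5) by simp
    then show ?thesis using lab'[of j j'] cut by simp
  next
    case inner
    have "c j = c j' \<and> offset c dir \<beta> j a = offset c dir \<beta> j' a'"
      using uniq[of j a j' a'] inner assms(5) by simp
    then show ?thesis using inn'[of j a] inn'[of j' a'] inner by simp
  next
    case mixed
    have "w (?t j' + a') \<noteq> w (?t j)"
      using inn[OF mixed(3,4), THEN conjunct1] mixed(1) by blast
    then show ?thesis using mixed assms(5) by simp
  next
    case mixed'
    have "w (?t j + a) \<noteq> w (?t j')"
      using inn[OF mixed'(1,2), THEN conjunct1] mixed'(4) by blast
    then show ?thesis using mixed' assms(5) by simp
  qed
qed

context reduced_walk
begin

definition similar :: "nat \<Rightarrow> nat \<Rightarrow> bool" where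
  "similar i j \<longleftrightarrow> seg i = seg j \<or> seg i = reverse_seg (seg j)"

lemma similar_sym: "similar i j \<Longrightarrow> similar j i"
  by (auto simp: similar_def)

lemma similar_trans: "similar i j \<Longrightarrow> similar j l \<Longrightarrow> similar i l"
  by (auto simp: similar_def)

definition rep :: "nat \<Rightarrow> nat" where
  "rep j = (LEAST i. i < num_segs \<and> similar i j)"

definition forward :: "nat \<Rightarrow> bool" where
  "forward j \<longleftrightarrow> seg (rep j) = seg j"

definition label :: "nat \<Rightarrow> nat" where
  "label j = (LEAST i. i \<le> num_segs \<and> w (cut i) = w (cut j))"

lemma rep: assumes "j < num_segs" shows "rep j < num_segs" "similar (rep j) j"
proof -
  have "j < num_segs \<and> similar j j" using assms by (simp add: similar_def)
  then have "rep j < num_segs \<and> similar (rep j) j" unfolding rep_def by (rule LeastI)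
  then show "rep j < num_segs" "similar (rep j) j" by auto
qed

lemma rep_cong:
  assumes "similar i j"
  shows "rep i = rep j"
proof -
  have "similar l i \<longleftrightarrow> similar l j" for l
    using similar_trans[OF _ assms] similar_trans[OF _ similar_sym[OF assms]] by blast
  then show ?thesis by (simp add: rep_def)
qed

lemma rep_rep: "j < num_segs \<Longrightarrow> rep (rep j) = rep j"
  by (intro rep_cong rep)

lemma rep_mate:
  assumes "j < num_segs"
  shows "\<exists>j'<num_segs. j' \<noteq> j \<and> rep j' = rep j"
proof -
  obtain j' where "j' < num_segs" "j' \<noteq> j" "similar j' j"
    using seg_mate[OF assms] unfolding similar_def by blast
  then show ?thesis using rep_cong[of j' j] by blast
qed

lemma label: assumes "j \<le> num_segs" shows "label j \<le> num_segs" "w (cut (label j)) = w (cut j)"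
proof -
  have "j \<le> num_segs \<and> w (cut j) = w (cut j)" using assms by simp
  then have "label j \<le> num_segs \<and> w (cut (label j)) = w (cut j)" unfolding label_def by (rule LeastI)
  then show "label j \<le> num_segs" "w (cut (label j)) = w (cut j)" by auto
qed

lemma label_eq_iff:
  assumes "i \<le> num_segs" "j \<le> num_segs"
  shows "label i = label j \<longleftrightarrow> w (cut i) = w (cut j)"
proof
  assume "label i = label j"
  then show "w (cut i) = w (cut j)" using label(2)[OF assms(1)] label(2)[OF assms(2)] by simp
next
  assume "w (cut i) = w (cut j)"
  then show "label i = label j" unfolding label_def by simp
qed

definition seg_len :: "nat \<Rightarrow> nat" where
  "seg_len j = cut (Suc j) - cut j"

lemma seg_len: "j < num_segs \<Longrightarrow> cut j + seg_len j = cut (Suc j)" "j < num_segs \<Longrightarrow> 0 < seg_len j"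
  using cut_less[of j "Suc j"] by (auto simp: seg_len_def)

lemma length_seg: "length (snd (seg j)) = seg_len j"
  by (simp add: seg_def seg_len_def)

lemma similar_len: "similar i j \<Longrightarrow> seg_len i = seg_len j"
  by (auto simp: similar_def reverse_seg_def length_seg[symmetric])

lemma fst_seg_nth: "j < num_segs \<Longrightarrow> a \<le> seg_len j \<Longrightarrow> fst (seg j) ! a = w (cut j + a)"
  using seg_len[of j] by (simp add: seg_def del: upt_Suc)

lemma length_fst_seg: "j < num_segs \<Longrightarrow> length (fst (seg j)) = Suc (seg_len j)"
  using seg_len[of j] by (simp add: seg_def del: upt_Suc)

lemma corner_in_rep:
  assumes "j < num_segs" "a \<le> seg_len j"
  shows "w (cut j + a) = w (cut (rep j) + (if forward j then a else seg_len j - a))"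
proof -
  have len: "seg_len (rep j) = seg_len j" using rep(2)[OF assms(1)] by (rule similar_len)
  show ?thesis
  proof (cases "forward j")
    case True
    then show ?thesis
      using fst_seg_nth[OF assms] fst_seg_nth[OF rep(1)[OF assms(1)], of a] assms(2) len by (simp add: forward_def)
  next
    case False
    then have "seg (rep j) = reverse_seg (seg j)" using rep(2)[OF assms(1)] by (simp add: similar_def forward_def)
    then have "fst (seg (rep j)) ! (seg_len j - a) = fst (seg j) ! a"
      using assms length_fst_seg[OF assms(1)] by (simp add: reverse_seg_def rev_nth)
    then show ?thesis
      using fst_seg_nth[OF assms] fst_seg_nth[OF rep(1)[OF assms(1)], of "seg_len j - a"] len False by simp
  qed
qed

text \<open>
  Of the two visits to an inner vertex of a segment, one lies in the segment itself and the other in a different, similar one. So two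
  segments that represent their classes cannot both contain a visit unless they coincide.
\<close>

lemma rep_position_unique:
  assumes i: "i < num_segs" "rep i = i" and i': "i' < num_segs" "rep i' = i'"
    and a: "0 < a" "a < seg_len i" and a': "0 < a'" "a' < seg_len i'"
    and eq: "w (cut i + a) = w (cut i' + a')"
  shows "i = i' \<and> a = a'"
proof (cases "cut i + a = cut i' + a'")
  case True
  have "i = i'"
    using segment_disjoint[OF i(1) i'(1), of "cut i + a"] a a' seg_len[OF i(1)] seg_len[OF i'(1)] True
    by linarith
  then show ?thesis using True by simp
next
  case False
  define x where "x = w (cut i + a)"
  have bounds: "cut i < cut i + a" "cut i + a < cut (Suc i)" "cut i' < cut i' + a'" "cut i' + a' < cut (Suc i')"
    using a a' seg_len[OF i(1)] seg_len[OF i'(1)] by auto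
  have ns: "\<not> special x" using inner_nonspecial[OF i(1) bounds(1,2)] by (simp add: x_def)
  have V: "visits x = {cut i + a, cut i' + a'}"
    using inner_nonspecial[OF i(1) bounds(1,2)] inner_nonspecial[OF i'(1) bounds(3,4)] eq False
    by (intro nonspecial_two_visits) (auto simp: x_def)
  obtain j where j: "j < num_segs" "j \<noteq> i" "rep j = rep i" using rep_mate[OF i(1)] by blast
  have sim: "similar j i"
    using similar_trans[OF similar_sym[OF rep(2)[OF j(1)]]] rep(2)[OF i(1)] j(3) by simp
  have len: "seg_len j = seg_len i" using sim by (rule similar_len)
  define b where "b = (if seg j = seg i then a else seg_len i - a)"
  have b: "0 < b" "b < seg_len j" using a len by (auto simp: b_def)
  have "fst (seg j) ! b = fst (seg i) ! a"
  proof (cases "seg j = seg i")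
    case False
    then have "seg j = reverse_seg (seg i)" using sim by (simp add: similar_def)
    then show ?thesis using False a length_fst_seg[OF i(1)] by (simp add: b_def reverse_seg_def rev_nth)
  qed (simp add: b_def)
  then have "w (cut j + b) = x"
    using fst_seg_nth[OF j(1), of b] fst_seg_nth[OF i(1), of a] a b by (simp add: x_def)
  have jb: "cut j < cut j + b" "cut j + b < cut (Suc j)" using b seg_len[OF j(1)] by auto
  then have "cut j + b \<in> visits x"
    using inner_nonspecial[OF j(1) jb] \<open>w (cut j + b) = x\<close> by (simp add: visits_def)
  moreover have "cut j + b \<noteq> cut i + a"
    using segment_disjoint[OF j(1) i(1) jb] bounds j(2) by auto
  ultimately have "cut j + b = cut i' + a'" using V by auto
  then have "j = i'" using segment_disjoint[OF j(1) i'(1) jb] bounds by auto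
  then show ?thesis using j i i' by simp
qed

lemma start_eq_cut:
  assumes "\<And>j. j < num_segs \<Longrightarrow> length (\<beta> (c j)) = seg_len j" "j \<le> num_segs"
  shows "start c \<beta> j = cut j"
  using assms(2) by (induction j) (use assms(1) seg_len(1) in \<open>auto simp: start_def cut_0\<close>)

lemma described:
  assumes c: "\<And>j. j < num_segs \<Longrightarrow> c j = rep j" and dir: "\<And>j. j < num_segs \<Longrightarrow> dir j = forward j"
    and lab: "\<And>j. j \<le> num_segs \<Longrightarrow> lab j = label j"
    and \<beta>: "\<And>j. j < num_segs \<Longrightarrow> \<beta> (rep j) = snd (seg (rep j))"
  shows "described_by n w num_segs c dir lab \<beta>"
    and "concat (map (\<lambda>j. orient (dir j) (\<beta> (c j))) [0..<num_segs]) = map sg [0..<n]"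
proof -
  have len: "length (\<beta> (c j)) = seg_len j" if "j < num_segs" for j
    using similar_len[OF rep(2)[OF that]] c[OF that] \<beta>[OF that] by (simp add: length_seg)
  note st = start_eq_cut[of \<beta> c, OF len]
  have off: "offset c dir \<beta> j a = (if forward j then a else seg_len j - a)" if "j < num_segs" for j a
    using that by (simp add: offset_def dir len)
  have rp: "w (cut j + a) = w (cut (c j) + offset c dir \<beta> j a)" if "j < num_segs" "a \<le> seg_len j" for j a
    unfolding off[OF that(1)] using corner_in_rep[OF that] c that by simp
  show "described_by n w num_segs c dir lab \<beta>"
    unfolding described_by_def
  proof (intro conjI allI impI)
    fix i assume "i \<le> n"
    from corner_in_segment[OF this]
    show "(\<exists>j\<le>num_segs. i = start c \<beta> j) \<or>
          (\<exists>j<num_segs. \<exists>a. 0 < a \<and> a < length (\<beta> (c j)) \<and> i = start c \<beta> j + a)"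
    proof
      assume "\<exists>j<num_segs. cut j < i \<and> i < cut (Suc j)"
      then obtain j where j: "j < num_segs" "cut j < i" "i < cut (Suc j)" by blast
      then have "0 < i - cut j \<and> i - cut j < length (\<beta> (c j)) \<and> i = start c \<beta> j + (i - cut j)"
        using len[OF j(1)] st[of j] seg_len[OF j(1)] by simp
      then show ?thesis using j(1) by blast
    qed (use st in auto)
  next
    fix j j' assume "j \<le> num_segs" "j' \<le> num_segs"
    then show "(w (start c \<beta> j) = w (start c \<beta> j')) = (lab j = lab j')"
      using st lab label_eq_iff by simp
  next
    fix j a j' assume j: "j < num_segs" "0 < a \<and> a < length (\<beta> (c j))" "j' \<le> num_segs"
    then have "\<not> special (w (cut j + a))"
      using inner_nonspecial[OF j(1), of "cut j + a"] len[OF j(1)] seg_len[OF j(1)] by simp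
    then show "w (start c \<beta> j + a) \<noteq> w (start c \<beta> j')"
      using special_cut[OF j(3)] st j by (metis less_imp_le_nat)
  next
    fix j a assume j: "j < num_segs" "0 < a \<and> a < length (\<beta> (c j))"
    then show "w (start c \<beta> j + a) = w (start c \<beta> (c j) + offset c dir \<beta> j a)"
      using rp[OF j(1), of a] len[OF j(1)] st rep(1)[OF j(1)] c by simp
  next
    fix j a j' a' assume j: "j < num_segs" "0 < a \<and> a < length (\<beta> (c j))"
      "j' < num_segs" "0 < a' \<and> a' < length (\<beta> (c j'))"
      and "w (start c \<beta> j + a) = w (start c \<beta> j' + a')"
    then have eq: "w (cut (c j) + offset c dir \<beta> j a) = w (cut (c j') + offset c dir \<beta> j' a')"
      using rp[OF j(1), of a] rp[OF j(3), of a'] len st by simp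
    have "c j = c j' \<and> offset c dir \<beta> j a = offset c dir \<beta> j' a'"
    proof (rule rep_position_unique[OF _ _ _ _ _ _ _ _ eq])
      show "c j < num_segs" "rep (c j) = c j" "c j' < num_segs" "rep (c j') = c j'"
        using j c rep rep_rep by auto
      show "0 < offset c dir \<beta> j a" "offset c dir \<beta> j a < seg_len (c j)"
        "0 < offset c dir \<beta> j' a'" "offset c dir \<beta> j' a' < seg_len (c j')"
        using j len off similar_len[OF rep(2)[OF j(1)]] similar_len[OF rep(2)[OF j(3)]] c by auto
    qed
    then show "c j = c j'" "offset c dir \<beta> j a = offset c dir \<beta> j' a'" by auto
  qed
  have seg_signs: "orient (dir j) (\<beta> (c j)) = map sg [cut j..<cut (Suc j)]" if "j < num_segs" for j
  proof -
    have "orient (dir j) (\<beta> (c j)) = snd (seg j)"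
      using rep(2)[OF that] c[OF that] dir[OF that] \<beta>[OF that]
      by (auto simp: orient_def forward_def similar_def reverse_seg_def)
    then show ?thesis by (simp add: seg_def)
  qed
  have "concat (map (\<lambda>j. orient (dir j) (\<beta> (c j))) [0..<p]) = map sg [0..<cut p]" if "p \<le> num_segs" for p
    using that
  proof (induction p)
    case (Suc p)
    then show ?case
      using seg_signs[of p] seg_len[of p] upt_add_eq_append[of 0 "cut p" "seg_len p"]
      by simp
  qed (simp add: cut_0)
  from this[of num_segs] show "concat (map (\<lambda>j. orient (dir j) (\<beta> (c j))) [0..<num_segs]) = map sg [0..<n]"
    by (simp add: cut_num_segs)
qed

end

section \<open>Counting the reductions to a word of paired segments\<close>

text \<open>
  Cauchy-Schwarz for two of the factors; each of the others is bounded by its norm.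
\<close>

lemma sum_prod_class_le:
  fixes a :: "'j \<Rightarrow> 'b \<Rightarrow> real"
  assumes "finite K" "finite B" "i \<in> K" "j \<in> K" "i \<noteq> j" "\<And>j b. 0 \<le> a j b"
  shows "(\<Sum>b\<in>B. \<Prod>j\<in>K. a j b) \<le> (\<Prod>j\<in>K. sqrt (\<Sum>b\<in>B. (a j b)\<^sup>2))"
proof -
  define s where "s j = sqrt (\<Sum>b\<in>B. (a j b)\<^sup>2)" for j
  define K' where "K' = K - {i, j}"
  have K: "K = insert i (insert j K')" "i \<notin> insert j K'" "j \<notin> K'" "finite K'"
    using assms by (auto simp: K'_def)
  have s0: "0 \<le> s j" for j by (simp add: s_def sum_nonneg)
  have le: "a j b \<le> s j" if "b \<in> B" for j b
  proof -
    have "(a j b)\<^sup>2 \<le> (\<Sum>b\<in>B. (a j b)\<^sup>2)" using that assms(2) by (intro member_le_sum) auto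
    then show ?thesis unfolding s_def by (rule real_le_rsqrt)
  qed
  have cs: "(\<Sum>b\<in>B. a i b * a j b) \<le> s i * s j"
    using L2_set_mult_ineq[of "a i" "a j" B] assms(6) by (simp add: s_def L2_set_def)
  have "(\<Sum>b\<in>B. \<Prod>j\<in>K. a j b) = (\<Sum>b\<in>B. (a i b * a j b) * (\<Prod>j\<in>K'. a j b))"
    using K by (simp add: mult.assoc)
  also have "\<dots> \<le> (\<Sum>b\<in>B. (a i b * a j b) * (\<Prod>j\<in>K'. s j))"
    using assms(6) le by (intro sum_mono mult_left_mono prod_mono) auto
  also have "\<dots> = (\<Sum>b\<in>B. a i b * a j b) * (\<Prod>j\<in>K'. s j)"
    by (rule sum_distrib_right[symmetric])
  also have "\<dots> \<le> s i * s j * (\<Prod>j\<in>K'. s j)"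
    using cs s0 by (intro mult_right_mono prod_nonneg) auto
  also have "\<dots> = (\<Prod>j\<in>K. s j)" using K by (simp add: mult.assoc)
  finally show ?thesis by (simp add: s_def)
qed

text \<open>
  The sum factorises over the classes of \<open>c\<close>, each of which has at least two members.
\<close>

lemma sum_prod_classes_le:
  fixes a :: "'j \<Rightarrow> 'b \<Rightarrow> real"
  assumes J: "finite J" and B: "finite B" and nonneg: "\<And>j b. 0 \<le> a j b"
    and mate: "\<And>j. j \<in> J \<Longrightarrow> \<exists>i\<in>J. i \<noteq> j \<and> c i = c j"
  shows "(\<Sum>\<beta>\<in>PiE (c ` J) (\<lambda>_. B). \<Prod>j\<in>J. a j (\<beta> (c j))) \<le> (\<Prod>j\<in>J. sqrt (\<Sum>b\<in>B. (a j b)\<^sup>2))"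
proof -
  define K where "K x = {j \<in> J. c j = x}" for x
  have group: "(\<Prod>j\<in>J. f j) = (\<Prod>x\<in>c ` J. \<Prod>j\<in>K x. f j)" for f :: "'j \<Rightarrow> real"
    unfolding K_def by (rule prod.image_gen[OF J])
  have "(\<Sum>\<beta>\<in>PiE (c ` J) (\<lambda>_. B). \<Prod>j\<in>J. a j (\<beta> (c j))) =
        (\<Sum>\<beta>\<in>PiE (c ` J) (\<lambda>_. B). \<Prod>x\<in>c ` J. \<Prod>j\<in>K x. a j (\<beta> x))"
    unfolding group by (intro sum.cong prod.cong) (auto simp: K_def)
  also have "\<dots> = (\<Prod>x\<in>c ` J. \<Sum>b\<in>B. \<Prod>j\<in>K x. a j b)"
    using J B by (subst prod_sum_PiE[symmetric]) auto
  also have "\<dots> \<le> (\<Prod>x\<in>c ` J. \<Prod>j\<in>K x. sqrt (\<Sum>b\<in>B. (a j b)\<^sup>2))"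
  proof (rule prod_mono, intro conjI)
    fix x assume "x \<in> c ` J"
    then obtain j where "j \<in> J" "x = c j" by auto
    then obtain i where "i \<in> K x" "j \<in> K x" "i \<noteq> j" using mate[of j] by (auto simp: K_def)
    then show "(\<Sum>b\<in>B. \<Prod>j\<in>K x. a j b) \<le> (\<Prod>j\<in>K x. sqrt (\<Sum>b\<in>B. (a j b)\<^sup>2))"
      using J B nonneg by (intro sum_prod_class_le) (auto simp: K_def)
  qed (auto intro!: sum_nonneg prod_nonneg nonneg)
  also have "\<dots> = (\<Prod>j\<in>J. sqrt (\<Sum>b\<in>B. (a j b)\<^sup>2))" by (rule group[symmetric])
  finally show ?thesis .
qed

text \<open>
  Cut \<open>w\<close> behind the letter that survives as the last one of \<open>s\<close>.
\<close>

lemma red_count_append_le: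
  assumes "s \<noteq> []"
  shows "red_count w (s @ \<alpha>) \<le> (\<Sum>i<length w. red_count (take (Suc i) w) s * red_count (drop (Suc i) w) \<alpha>)"
proof -
  obtain \<beta> y where s: "s = \<beta> @ [y]" using assms by (cases s rule: rev_cases) auto
  have "red_count w (s @ \<alpha>) =
     (\<Sum>i<length w. if w ! i = y then red_count (take i w) \<beta> * red_count (drop (Suc i) w) \<alpha> else 0)"
    using red_count_split[of w \<beta> y \<alpha>] by (simp add: s)
  also have "\<dots> \<le> (\<Sum>i<length w. red_count (take (Suc i) w) s * red_count (drop (Suc i) w) \<alpha>)"
  proof (rule sum_mono)
    fix i assume "i \<in> {..<length w}"
    then show "(if w ! i = y then red_count (take i w) \<beta> * red_count (drop (Suc i) w) \<alpha> else 0)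
        \<le> red_count (take (Suc i) w) s * red_count (drop (Suc i) w) \<alpha>"
      using red_count_frame[of "take i w" \<beta> y] by (auto simp: s take_Suc_conv_app_nth)
  qed
  finally show ?thesis .
qed

text \<open>
  Increasing lists of \<open>p\<close> positions between \<open>a\<close> and \<open>M\<close>: the ends of the first \<open>p\<close> of \<open>p + 1\<close> consecutive
  intervals.
\<close>

fun cut_lists :: "nat \<Rightarrow> nat \<Rightarrow> nat \<Rightarrow> nat list set" where
  "cut_lists a M 0 = {[]}"
| "cut_lists a M (Suc p) = (\<Union>b\<in>{a<..M}. (#) b ` cut_lists b M p)"

lemma finite_cut_lists: "finite (cut_lists a M p)"
  by (induction p arbitrary: a) auto

lemma card_cut_lists: "card (cut_lists a M p) \<le> Suc M ^ p"
proof (induction p arbitrary: a)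
  case (Suc p)
  have "card (cut_lists a M (Suc p)) \<le> (\<Sum>b\<in>{a<..M}. card ((#) b ` cut_lists b M p))"
    unfolding cut_lists.simps by (rule card_UN_le) simp
  also have "\<dots> \<le> (\<Sum>b\<in>{a<..M}. Suc M ^ p)"
    using Suc by (intro sum_mono) (simp add: card_image)
  also have "\<dots> = (M - a) * Suc M ^ p" by simp
  also have "\<dots> \<le> Suc M ^ Suc p" unfolding power_Suc by (intro mult_right_mono) auto
  finally show ?case .
qed simp

lemma red_count_concat_le:
  assumes "a \<le> M" "\<And>s. s \<in> set ss \<Longrightarrow> s \<noteq> []"
  shows "red_count (sign_interval k a M) (concat ss) \<le>
    (\<Sum>ts\<in>cut_lists a M (length ss).
       (\<Prod>j<length ss. red_count (sign_interval k ((a # ts) ! j) (ts ! j)) (ss ! j)) * red_count (sign_interval k (last (a # ts)) M) [])"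
  using assms
proof (induction ss arbitrary: a)
  case (Cons s ss)
  let ?T = "\<lambda>a ss ts. (\<Prod>j<length ss. red_count (sign_interval k ((a # ts) ! j) (ts ! j)) (ss ! j)) * red_count (sign_interval k (last (a # ts)) M) []"
  have "red_count (sign_interval k a M) (concat (s # ss)) \<le>
     (\<Sum>i<M - a. red_count (take (Suc i) (sign_interval k a M)) s * red_count (drop (Suc i) (sign_interval k a M)) (concat ss))"
    using red_count_append_le[of s "sign_interval k a M" "concat ss"] Cons.prems by simp
  also have "\<dots> = (\<Sum>b\<in>{a<..M}. red_count (sign_interval k a b) s * red_count (sign_interval k b M) (concat ss))"
    by (rule sum.reindex_bij_witness[of _ "\<lambda>b. b - Suc a" "\<lambda>i. a + Suc i"]) (auto simp: take_sign_interval drop_sign_interval)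
  also have "\<dots> \<le> (\<Sum>b\<in>{a<..M}. red_count (sign_interval k a b) s * (\<Sum>ts\<in>cut_lists b M (length ss). ?T b ss ts))"
    using Cons by (intro sum_mono mult_left_mono) auto
  also have "\<dots> = (\<Sum>b\<in>{a<..M}. \<Sum>ts\<in>cut_lists b M (length ss). ?T a (s # ss) (b # ts))"
    by (simp add: sum_distrib_left prod.lessThan_Suc_shift mult.assoc del: prod.lessThan_Suc)
  also have "\<dots> = (\<Sum>b\<in>{a<..M}. \<Sum>ts\<in>(#) b ` cut_lists b M (length ss). ?T a (s # ss) ts)"
    by (intro sum.cong[OF refl], subst sum.reindex) auto
  also have "\<dots> = (\<Sum>ts\<in>cut_lists a M (length (s # ss)). ?T a (s # ss) ts)"
    unfolding list.size(4) add_Suc_right cut_lists.simps add_0_right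
    by (intro sum.UNION_disjoint[symmetric]) (auto simp: finite_cut_lists)
  finally show ?case .
qed simp

text \<open>
  A block can be shared by consecutive intervals, which costs at most one factor \<open>growth k\<close> per interval; apart from that
  the numbers of blocks telescope.
\<close>

lemma prod_growth_cuts:
  assumes "ts \<in> cut_lists a M p" "a \<le> M"
  shows "(\<Prod>j<p. growth k ^ (ts ! j div (2 * k) + 1 - (a # ts) ! j div (2 * k))) *
           growth k ^ (M div (2 * k) + 1 - last (a # ts) div (2 * k)) =
         growth k ^ (M div (2 * k) + p + 1 - a div (2 * k))"
  using assms
proof (induction p arbitrary: a ts)
  case (Suc p)
  then obtain b ts' where b: "a < b" "b \<le> M" "ts' \<in> cut_lists b M p" "ts = b # ts'" by auto
  have "a div (2 * k) \<le> b div (2 * k)" "b div (2 * k) \<le> M div (2 * k)"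
    using b by (auto intro!: div_le_mono)
  then have "(b div (2 * k) + 1 - a div (2 * k)) + (M div (2 * k) + p + 1 - b div (2 * k)) =
      M div (2 * k) + Suc p + 1 - a div (2 * k)" by linarith
  then show ?case
    using Suc.IH[OF b(3,2)]
    by (simp add: b(4) prod.lessThan_Suc_shift mult.assoc del: prod.lessThan_Suc flip: power_add)
qed simp

lemma cut_lists_le:
  assumes "ts \<in> cut_lists a M p" "a \<le> M"
  shows "j < p \<Longrightarrow> (a # ts) ! j \<le> ts ! j" "j < p \<Longrightarrow> ts ! j \<le> M" "last (a # ts) \<le> M"
proof -
  have "(\<forall>j<p. (a # ts) ! j \<le> ts ! j \<and> ts ! j \<le> M) \<and> last (a # ts) \<le> M"
    using assms
  proof (induction p arbitrary: a ts)
    case (Suc p)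
    then obtain b ts' where b: "a < b" "b \<le> M" "ts' \<in> cut_lists b M p" "ts = b # ts'" by auto
    show ?case using Suc.IH[OF b(3,2)] b by (auto simp: less_Suc_eq_0_disj)
  qed simp
  then show "j < p \<Longrightarrow> (a # ts) ! j \<le> ts ! j" "j < p \<Longrightarrow> ts ! j \<le> M" "last (a # ts) \<le> M" by auto
qed

definition segment_words :: "nat \<Rightarrow> bool list set" where
  "segment_words N = words_upto N - {[]}"

lemma sum_sq_orient_le:
  assumes "length w \<le> N"
  shows "(\<Sum>b\<in>segment_words N. (real (red_count w (orient d b)))\<^sup>2) \<le> real (sq_norm w)"
proof -
  have "(\<Sum>b\<in>segment_words N. (red_count w (orient d b))\<^sup>2) =
        (\<Sum>b\<in>orient d ` segment_words N. (red_count w b)\<^sup>2)"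
  proof (rule sum.reindex_cong[symmetric])
    show "inj_on (orient d) (segment_words N)"
      unfolding orient_def by (auto simp: inj_on_def) (metis flip_rev_flip_rev)
  qed auto
  also have "\<dots> \<le> (\<Sum>b\<in>words_upto N. (red_count w b)\<^sup>2)"
    by (intro sum_mono2 finite_words_upto) (auto simp: orient_def segment_words_def words_upto_def)
  finally have "(\<Sum>b\<in>segment_words N. (red_count w (orient d b))\<^sup>2) \<le> sq_norm w"
    by (simp add: sq_norm_words_upto[OF assms])
  then show ?thesis by (simp flip: of_nat_power of_nat_sum)
qed

text \<open>
  Once the cuts are fixed, the number of reductions is a product over the intervals, to which Cauchy-Schwarz applies. The final interval
  carries the letters behind the last segment, which are matched among themselves.
\<close>

lemma sum_red_count_le:
  assumes k: "k \<ge> 1" and mate: "\<And>j. j < p \<Longrightarrow> \<exists>i<p. i \<noteq> j \<and> c i = c j"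
  shows "(\<Sum>\<beta>\<in>PiE (c ` {..<p}) (\<lambda>_. segment_words M).
            real (red_count (sign_interval k 0 M) (concat (map (\<lambda>j. orient (dir j) (\<beta> (c j))) [0..<p]))))
         \<le> real (Suc M ^ p) * growth k ^ (M div (2 * k) + p + 1)"
proof -
  let ?F = "PiE (c ` {..<p}) (\<lambda>_. segment_words M)"
  define chunk where "chunk ts j = sign_interval k ((0 # ts) ! j) (ts ! j)" for ts j
  define rest where "rest ts = sign_interval k (last (0 # ts)) M" for ts
  have fin: "finite (segment_words M)" by (simp add: segment_words_def finite_words_upto)
  have G: "growth k \<ge> 0" using growth_ge_1[OF k] by simp
  have "(\<Sum>\<beta>\<in>?F. real (red_count (sign_interval k 0 M) (concat (map (\<lambda>j. orient (dir j) (\<beta> (c j))) [0..<p]))))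
      \<le> (\<Sum>\<beta>\<in>?F. \<Sum>ts\<in>cut_lists 0 M p.
          (\<Prod>j<p. real (red_count (chunk ts j) (orient (dir j) (\<beta> (c j))))) * real (red_count (rest ts) []))"
  proof (rule sum_mono)
    fix \<beta> assume \<beta>: "\<beta> \<in> ?F"
    define ss where "ss = map (\<lambda>j. orient (dir j) (\<beta> (c j))) [0..<p]"
    have ne: "s \<noteq> []" if s: "s \<in> set ss" for s
    proof -
      obtain j where j: "j < p" "s = orient (dir j) (\<beta> (c j))" using s by (auto simp: ss_def)
      then have "\<beta> (c j) \<in> segment_words M" using \<beta> by (intro PiE_mem[OF \<beta>]) auto
      then show ?thesis using j by (auto simp: segment_words_def orient_def flip_rev_def)
    qed
    have len: "length ss = p" by (simp add: ss_def)
    have "red_count (sign_interval k 0 M) (concat ss) \<le> (\<Sum>ts\<in>cut_lists 0 M p.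
       (\<Prod>j<p. red_count (chunk ts j) (ss ! j)) * red_count (rest ts) [])"
      using red_count_concat_le[of 0 M ss k] ne unfolding chunk_def rest_def len by blast
    also have "\<dots> = (\<Sum>ts\<in>cut_lists 0 M p.
       (\<Prod>j<p. red_count (chunk ts j) (orient (dir j) (\<beta> (c j)))) * red_count (rest ts) [])"
      by (intro sum.cong prod.cong arg_cong2[of _ _ _ _ "(*)"]) (auto simp: ss_def)
    finally have "red_count (sign_interval k 0 M) (concat ss) \<le> (\<Sum>ts\<in>cut_lists 0 M p.
       (\<Prod>j<p. red_count (chunk ts j) (orient (dir j) (\<beta> (c j)))) * red_count (rest ts) [])" .
    then show "real (red_count (sign_interval k 0 M) (concat (map (\<lambda>j. orient (dir j) (\<beta> (c j))) [0..<p]))) \<le>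
       (\<Sum>ts\<in>cut_lists 0 M p.
          (\<Prod>j<p. real (red_count (chunk ts j) (orient (dir j) (\<beta> (c j))))) * real (red_count (rest ts) []))"
      unfolding ss_def[symmetric] by (simp flip: of_nat_prod of_nat_mult of_nat_sum)
  qed
  also have "\<dots> = (\<Sum>ts\<in>cut_lists 0 M p. (\<Sum>\<beta>\<in>?F.
          \<Prod>j<p. real (red_count (chunk ts j) (orient (dir j) (\<beta> (c j))))) * real (red_count (rest ts) []))"
    by (subst sum.swap) (simp add: sum_distrib_right)
  also have "\<dots> \<le> (\<Sum>ts\<in>cut_lists 0 M p. growth k ^ (M div (2 * k) + p + 1))"
  proof (rule sum_mono)
    fix ts assume ts: "ts \<in> cut_lists 0 M p"
    note le = cut_lists_le[OF ts le0]
    have "(\<Sum>\<beta>\<in>?F. \<Prod>j<p. real (red_count (chunk ts j) (orient (dir j) (\<beta> (c j)))))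
        \<le> (\<Prod>j<p. sqrt (\<Sum>b\<in>segment_words M. (real (red_count (chunk ts j) (orient (dir j) b)))\<^sup>2))"
      by (rule sum_prod_classes_le) (use fin mate in auto)
    also have "\<dots> \<le> (\<Prod>j<p. growth k ^ (ts ! j div (2 * k) + 1 - (0 # ts) ! j div (2 * k)))"
    proof (intro prod_mono conjI)
      fix j assume j: "j \<in> {..<p}"
      have "length (chunk ts j) \<le> M" unfolding chunk_def using le(2)[of j] j by simp
      then have "sqrt (\<Sum>b\<in>segment_words M. (real (red_count (chunk ts j) (orient (dir j) b)))\<^sup>2)
          \<le> sqrt (real (sq_norm (chunk ts j)))"
        by (intro real_sqrt_le_mono sum_sq_orient_le)
      also have "\<dots> \<le> growth k ^ (ts ! j div (2 * k) + 1 - (0 # ts) ! j div (2 * k))"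
        unfolding chunk_def using le(1)[of j] j by (intro sqrt_sq_norm_interval[OF k]) auto
      finally show "sqrt (\<Sum>b\<in>segment_words M. (real (red_count (chunk ts j) (orient (dir j) b)))\<^sup>2)
          \<le> growth k ^ (ts ! j div (2 * k) + 1 - (0 # ts) ! j div (2 * k))" .
    qed (simp add: sum_nonneg)
    finally have 1: "(\<Sum>\<beta>\<in>?F. \<Prod>j<p. real (red_count (chunk ts j) (orient (dir j) (\<beta> (c j)))))
        \<le> (\<Prod>j<p. growth k ^ (ts ! j div (2 * k) + 1 - (0 # ts) ! j div (2 * k)))" .
    have 2: "real (red_count (rest ts) []) \<le> growth k ^ (M div (2 * k) + 1 - last (0 # ts) div (2 * k))"
      unfolding rest_def by (rule order_trans[OF red_count_le_sqrt sqrt_sq_norm_interval[OF k le(3)]])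
    have "(\<Sum>\<beta>\<in>?F. \<Prod>j<p. real (red_count (chunk ts j) (orient (dir j) (\<beta> (c j))))) * real (red_count (rest ts) [])
        \<le> (\<Prod>j<p. growth k ^ (ts ! j div (2 * k) + 1 - (0 # ts) ! j div (2 * k))) *
           growth k ^ (M div (2 * k) + 1 - last (0 # ts) div (2 * k))"
      using G by (intro mult_mono 1 2 prod_nonneg) auto
    also have "\<dots> = growth k ^ (M div (2 * k) + p + 1)"
      using prod_growth_cuts[OF ts le0] by simp
    finally show "(\<Sum>\<beta>\<in>?F. \<Prod>j<p. real (red_count (chunk ts j) (orient (dir j) (\<beta> (c j))))) * real (red_count (rest ts) [])
        \<le> growth k ^ (M div (2 * k) + p + 1)" .
  qed
  also have "\<dots> = real (card (cut_lists 0 M p)) * growth k ^ (M div (2 * k) + p + 1)" by simp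
  also have "\<dots> \<le> real (Suc M ^ p) * growth k ^ (M div (2 * k) + p + 1)"
    using card_cut_lists[of 0 M p] G by (intro mult_right_mono) (simp_all only: of_nat_le_iff zero_le_power)
  finally show ?thesis .
qed

section \<open>Counting admissible classes\<close>

lemma count_list_card: "count_list xs x = card {i. i < length xs \<and> xs ! i = x}"
proof -
  have "{i. i < length xs \<and> xs ! i = x} = {i. i < length xs \<and> x = xs ! i}" by auto
  then show ?thesis by (simp add: count_list_eq_length_filter length_filter_conv_card)
qed

lemma count_ge_2_other:
  assumes "count_list xs x \<ge> 2" "i < length xs" "xs ! i = x"
  shows "\<exists>j<length xs. j \<noteq> i \<and> xs ! j = x"
proof (rule ccontr)
  assume "\<not> ?thesis"
  then have "{i. i < length xs \<and> xs ! i = x} = {i}" using assms by auto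
  then show False using assms(1) by (simp add: count_list_card)
qed

lemma relabel_relI:
  assumes "length xs = length ys"
    and "\<And>i j. i < length xs \<Longrightarrow> j < length xs \<Longrightarrow> xs ! i = xs ! j \<longleftrightarrow> ys ! i = ys ! j"
  shows "(xs, ys) \<in> relabel_rel"
proof -
  define pos where "pos x = (SOME i. i < length xs \<and> xs ! i = x)" for x
  have pos: "pos x < length xs" "xs ! pos x = x" if "x \<in> set xs" for x
  proof -
    have "\<exists>i. i < length xs \<and> xs ! i = x" using that by (auto simp: in_set_conv_nth)
    then have "pos x < length xs \<and> xs ! pos x = x" unfolding pos_def by (rule someI_ex)
    then show "pos x < length xs" "xs ! pos x = x" by auto
  qed
  have "inj_on (\<lambda>x. ys ! pos x) (set xs)"
  proof (rule inj_onI)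
    fix x y assume x: "x \<in> set xs" and y: "y \<in> set xs" and "ys ! pos x = ys ! pos y"
    then have "xs ! pos x = xs ! pos y" using assms(2)[OF pos(1)[OF x] pos(1)[OF y]] by blast
    then show "x = y" unfolding pos(2)[OF x] pos(2)[OF y] .
  qed
  moreover have "ys = map (\<lambda>x. ys ! pos x) xs"
  proof (rule nth_equalityI)
    fix i assume "i < length ys"
    then have i: "i < length xs" by (simp add: assms(1))
    then have x: "xs ! i \<in> set xs" by (rule nth_mem)
    have "ys ! i = ys ! pos (xs ! i)"
      using assms(2)[OF i pos(1)[OF x]] pos(2)[OF x] by (simp only: simp_thms)
    then show "ys ! i = map (\<lambda>x. ys ! pos x) xs ! i" by (simp only: nth_map[OF i])
  qed (simp add: assms(1))
  ultimately show ?thesis unfolding relabel_rel_def by blast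
qed

lemma nth_walk_edges:
  assumes "i < length X"
  shows "walk_edges b X ! i = (if fst (X ! i) then (verts b X ! i, verts b X ! Suc i) else (verts b X ! Suc i, verts b X ! i))"
  using assms
proof (induction b X arbitrary: i rule: walk_edges.induct)
  case (2 b s x X)
  then show ?case by (cases i) (auto simp: verts_def)
qed simp

lemma nth_verts_Suc: "i < length X \<Longrightarrow> verts b X ! Suc i = snd (X ! i)"
  by (simp add: verts_def)

text \<open>
  The part of a description whose number of values is polynomial in the length of the word: the representative of
  each segment, the direction relative to it, and for each segment start the first start at the same vertex.
\<close>

definition shapes :: "nat \<Rightarrow> ((nat \<Rightarrow> nat) \<times> (nat \<Rightarrow> bool) \<times> (nat \<Rightarrow> nat)) set" where
  "shapes p = {c \<in> PiE {..<p} (\<lambda>_. {..<p}). \<forall>j<p. \<exists>i<p. i \<noteq> j \<and> c i = c j} \<times>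
     PiE {..<p} (\<lambda>_. UNIV) \<times> PiE {..p} (\<lambda>_. {..p})"

lemma finite_shapes: "finite (shapes p)"
proof -
  have "finite {c \<in> PiE {..<p} (\<lambda>_. {..<p}). \<forall>j<p. \<exists>i<p. i \<noteq> j \<and> c i = c j}"
    by (rule finite_subset[of _ "PiE {..<p} (\<lambda>_. {..<p})"]) (auto intro: finite_PiE)
  then show ?thesis unfolding shapes_def by (auto intro!: finite_cartesian_product finite_PiE)
qed

lemma card_shapes: "card (shapes p) \<le> p ^ p * 2 ^ p * Suc p ^ Suc p"
proof -
  have "card {c \<in> PiE {..<p} (\<lambda>_. {..<p}). \<forall>j<p. \<exists>i<p. i \<noteq> j \<and> c i = c j} \<le> card (PiE {..<p} (\<lambda>_. {..<p}))"
    by (intro card_mono finite_PiE) auto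
  also have "\<dots> = p ^ p" by (simp add: card_PiE)
  finally have "card {c \<in> PiE {..<p} (\<lambda>_. {..<p}). \<forall>j<p. \<exists>i<p. i \<noteq> j \<and> c i = c j} \<le> p ^ p" .
  moreover have "card (PiE {..<p} (\<lambda>_. UNIV :: bool set)) = 2 ^ p" by (simp add: card_PiE)
  moreover have "card (PiE {..p} (\<lambda>_. {..p})) = Suc p ^ Suc p" by (simp add: card_PiE)
  ultimately show ?thesis
    unfolding shapes_def card_cartesian_product mult.assoc by (simp only:) (rule mult_le_mono1)
qed

text \<open>
  The hypothesis on the length says that the number of vertices falls short of the maximal one by at most \<open>r\<close>.
\<close>

lemma reduced_walk_shape:
  assumes edges_repeated: "edges_repeated b R" and closed: "closed_walk b R"
    and rev: "\<forall>l\<in>set R. snd l = b \<or> count_list (map snd R) (snd l) \<ge> 2"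
    and defect: "length R + 2 \<le> 2 * card (set (verts b R)) + 2 * r"
  shows "\<exists>p c dir lab \<beta>. p \<le> 8 * r \<and> p \<le> length R \<and> (c, dir, lab) \<in> shapes p \<and>
    \<beta> \<in> PiE (c ` {..<p}) (\<lambda>_. segment_words (length R)) \<and>
    described_by (length R) ((!) (verts b R)) p c dir lab \<beta> \<and>
    map fst R = concat (map (\<lambda>j. orient (dir j) (\<beta> (c j))) [0..<p])"
proof -
  define n where "n = length R"
  define w where "w = (!) (verts b R)"
  define sg where "sg i = fst (R ! i)" for i
  define e where "e i = (if sg i then (w i, w (Suc i)) else (w (Suc i), w i))" for i
  have e_vars: "e i = walk_edges b R ! i" if "i < n" for i
    using nth_walk_edges[of i R b] that by (simp add: e_def sg_def w_def n_def)
  have w0: "w 0 = b" by (simp add: w_def verts_def)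
  have wn: "w n = b"
  proof -
    have "w n = last (verts b R)" by (simp add: w_def n_def last_conv_nth verts_def)
    then show ?thesis using closed by (simp add: closed_walk_def)
  qed
  interpret reduced_walk n w sg e
  proof
    show "e i = (if sg i then (w i, w (Suc i)) else (w (Suc i), w i))" for i by (rule e_def)
    show "w n = w 0" by (simp add: w0 wn)
    fix i
    {
      assume i: "i < n"
      then have "count_list (walk_edges b R) (walk_edges b R ! i) \<ge> 2"
        using edges_repeated by (simp add: edges_repeated_def n_def)
      from count_ge_2_other[OF this, of i] show "\<exists>j<n. j \<noteq> i \<and> e j = e i"
        using i e_vars by (auto simp: n_def)
    }
    assume i: "0 < i" "i < n" "w i \<noteq> w 0"
    then obtain i' where i': "i = Suc i'" by (cases i) auto
    have wi: "w i = snd (R ! i')" using i i' by (simp add: w_def n_def nth_verts_Suc)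
    have "R ! i' \<in> set R" using i i' by (simp add: n_def)
    then have "count_list (map snd R) (w i) \<ge> 2" using rev i(3) by (auto simp: wi w0)
    from count_ge_2_other[OF this, of i'] obtain j' where j': "j' < n" "j' \<noteq> i'" "snd (R ! j') = w i"
      using i i' wi by (auto simp: n_def)
    have wj: "w (Suc j') = w i" using j' by (simp add: w_def n_def nth_verts_Suc)
    then have "Suc j' \<noteq> n" using i(3) wn w0 by auto
    then show "\<exists>j<n. j \<noteq> i \<and> w j = w i" using j' wj i' by (intro exI[of _ "Suc j'"]) auto
  qed
  define p where "p = num_segs"
  have "w ` {..n} = set (verts b R)"
    unfolding w_def n_def by (auto simp: set_conv_nth verts_def less_Suc_eq_le)
  then have "n + 2 \<le> 2 * card (w ` {..n}) + 2 * r" using defect by (simp add: n_def)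
  then have p8: "p \<le> 8 * r"
    unfolding p_def num_segs_def special_corners_def by (rule special_bound)
  have pn: "p \<le> n"
  proof -
    have "card special_corners \<le> card {..<n}" by (intro card_mono) (auto simp: special_corners_def)
    then show ?thesis by (simp add: p_def num_segs_def)
  qed
  define c where "c = restrict rep {..<p}"
  define dir where "dir = restrict forward {..<p}"
  define lab where "lab = restrict label {..p}"
  define \<beta> where "\<beta> = restrict (\<lambda>i. snd (seg i)) (c ` {..<p})"
  have c: "c j = rep j" if "j < p" for j using that by (simp add: c_def)
  have sh: "(c, dir, lab) \<in> shapes p"
  proof -
    have "\<exists>i<p. i \<noteq> j \<and> c i = c j" if "j < p" for j
    proof -
      obtain i where "i < p" "i \<noteq> j" "rep i = rep j" using rep_mate[of j] \<open>j < p\<close> by (auto simp: p_def)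
      then show ?thesis using c \<open>j < p\<close> by (intro exI[of _ i]) simp
    qed
    then show ?thesis
      using rep(1) label(1) unfolding shapes_def c_def dir_def lab_def p_def by auto
  qed
  have words: "\<beta> \<in> PiE (c ` {..<p}) (\<lambda>_. segment_words (length R))"
  proof (rule PiE_I)
    fix i assume i: "i \<in> c ` {..<p}"
    then have ip: "i < p" using c rep(1) by (auto simp: p_def)
    have "snd (seg i) \<noteq> []" using length_seg[of i] seg_len(2)[of i] ip by (auto simp: p_def)
    moreover have "length (snd (seg i)) \<le> n"
      using length_seg[of i] seg_len(1)[of i] cut_le_n[of "Suc i"] ip by (simp add: p_def)
    ultimately show "\<beta> i \<in> segment_words (length R)"
      using i by (simp add: \<beta>_def segment_words_def words_upto_def n_def)
  qed (auto simp: \<beta>_def)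
  have descr: "described_by n w p c dir lab \<beta>"
    "concat (map (\<lambda>j. orient (dir j) (\<beta> (c j))) [0..<p]) = map sg [0..<n]"
  proof -
    have "\<beta> (rep j) = snd (seg (rep j))" if "j < num_segs" for j
    proof -
      have "c j \<in> c ` {..<p}" using that by (simp add: p_def)
      then show ?thesis using c[of j] that by (simp add: \<beta>_def p_def)
    qed
    then show "described_by n w p c dir lab \<beta>"
      "concat (map (\<lambda>j. orient (dir j) (\<beta> (c j))) [0..<p]) = map sg [0..<n]"
      unfolding p_def by (intro described; simp add: c_def dir_def lab_def p_def)+
  qed
  have signs: "map sg [0..<n] = map fst R"
    by (rule nth_equalityI) (auto simp: sg_def n_def)
  show ?thesis
    by (intro exI[of _ p] exI[of _ c] exI[of _ dir] exI[of _ lab] exI[of _ \<beta>] conjI)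
       (use p8 pn sh words descr signs in \<open>simp_all only: n_def w_def\<close>)
qed

type_synonym walk_code = "nat \<times> ((nat \<Rightarrow> nat) \<times> (nat \<Rightarrow> bool) \<times> (nat \<Rightarrow> nat)) \<times> (nat \<Rightarrow> bool list) \<times> bool list"

definition core_signs :: "nat \<Rightarrow> (nat \<Rightarrow> nat) \<times> (nat \<Rightarrow> bool) \<times> (nat \<Rightarrow> nat) \<Rightarrow> (nat \<Rightarrow> bool list) \<Rightarrow> bool list" where
  "core_signs p x \<beta> = concat (map (\<lambda>j. orient (fst (snd x) j) (\<beta> (fst x j))) [0..<p])"

text \<open>
  A code is a shape with sign words for the representatives, together with a reduction of the sign pattern to the sign
  word of the reduced walk.
\<close>

definition codes :: "nat \<Rightarrow> nat \<Rightarrow> nat \<Rightarrow> walk_code set" where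
  "codes k M P = (SIGMA p:{..P}. SIGMA x:shapes p. SIGMA \<beta>:PiE (fst x ` {..<p}) (\<lambda>_. segment_words M).
     reductions (sign_interval k 0 M) (core_signs p x \<beta>))"

lemma finite_segment_words: "finite (segment_words M)"
  by (simp add: segment_words_def finite_words_upto)

lemma finite_codes: "finite (codes k M P)"
  unfolding codes_def
  by (intro finite_SigmaI finite_shapes finite_reductions finite_PiE finite_segment_words) auto

lemma card_codes:
  "card (codes k M P) = (\<Sum>p\<le>P. \<Sum>x\<in>shapes p. \<Sum>\<beta>\<in>PiE (fst x ` {..<p}) (\<lambda>_. segment_words M).
     red_count (sign_interval k 0 M) (core_signs p x \<beta>))"
  unfolding codes_def
  by (simp add: card_SigmaI finite_SigmaI finite_shapes finite_reductions finite_PiE finite_segment_words card_reductions)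

text \<open>
  Without segments the reduced walk is empty.
\<close>

lemma card_codes_0: "card (codes k M 0) \<le> red_count (sign_interval k 0 M) []"
proof -
  have "card (codes k M 0) = card (shapes 0) * red_count (sign_interval k 0 M) []"
    by (simp add: card_codes core_signs_def)
  then show ?thesis using card_shapes[of 0] by simp
qed

lemma card_codes_le:
  assumes k: "k \<ge> 1" and P: "P \<le> M"
  shows "real (card (codes k M P)) \<le>
    real (Suc M) ^ (3 * P + 2) * 2 ^ P * growth k ^ (M div (2 * k) + P + 1)"
proof -
  have G: "growth k \<ge> 1" by (rule growth_ge_1[OF k])
  let ?g = "growth k ^ (M div (2 * k) + P + 1)"
  have "(\<Sum>x\<in>shapes p. \<Sum>\<beta>\<in>PiE (fst x ` {..<p}) (\<lambda>_. segment_words M). real (red_count (sign_interval k 0 M) (core_signs p x \<beta>)))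
      \<le> real (Suc M) ^ (3 * P + 1) * 2 ^ P * ?g" if p: "p \<le> P" for p
  proof -
    have "(\<Sum>x\<in>shapes p. \<Sum>\<beta>\<in>PiE (fst x ` {..<p}) (\<lambda>_. segment_words M). real (red_count (sign_interval k 0 M) (core_signs p x \<beta>)))
        \<le> (\<Sum>x\<in>shapes p. real (Suc M) ^ P * ?g)"
    proof (rule sum_mono)
      fix x assume "x \<in> shapes p"
      then have "(\<Sum>\<beta>\<in>PiE (fst x ` {..<p}) (\<lambda>_. segment_words M). real (red_count (sign_interval k 0 M) (core_signs p x \<beta>)))
          \<le> real (Suc M ^ p) * growth k ^ (M div (2 * k) + p + 1)"
        unfolding core_signs_def by (intro sum_red_count_le[OF k]) (auto simp: shapes_def)
      also have "\<dots> \<le> real (Suc M) ^ P * ?g"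
        unfolding of_nat_power using p G by (intro mult_mono power_increasing) auto
      finally show "(\<Sum>\<beta>\<in>PiE (fst x ` {..<p}) (\<lambda>_. segment_words M). real (red_count (sign_interval k 0 M) (core_signs p x \<beta>)))
          \<le> real (Suc M) ^ P * ?g" .
    qed
    also have "\<dots> = real (card (shapes p)) * (real (Suc M) ^ P * ?g)" by simp
    also have "\<dots> \<le> real (Suc M ^ P * 2 ^ P * Suc M ^ Suc P) * (real (Suc M) ^ P * ?g)"
    proof (intro mult_right_mono)
      have "card (shapes p) \<le> p ^ p * 2 ^ p * Suc p ^ Suc p" by (rule card_shapes)
      also have "\<dots> \<le> Suc M ^ P * 2 ^ P * Suc M ^ Suc P"
      proof (intro mult_mono)
        have "p ^ p \<le> Suc M ^ p" using p P by (intro power_mono) auto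
        also have "\<dots> \<le> Suc M ^ P" using p by (intro power_increasing) auto
        finally show "p ^ p \<le> Suc M ^ P" .
        have "Suc p ^ Suc p \<le> Suc M ^ Suc p" using p P by (intro power_mono) auto
        also have "\<dots> \<le> Suc M ^ Suc P" using p by (intro power_increasing) auto
        finally show "Suc p ^ Suc p \<le> Suc M ^ Suc P" .
      qed (use p in \<open>auto intro: power_increasing\<close>)
      finally show "real (card (shapes p)) \<le> real (Suc M ^ P * 2 ^ P * Suc M ^ Suc P)"
        by (simp only: of_nat_le_iff)
    qed (use G in auto)
    also have "\<dots> = real (Suc M) ^ (3 * P + 1) * 2 ^ P * ?g"
    proof -
      have "real (Suc M) ^ (3 * P + 1) = real (Suc M) ^ P * real (Suc M) ^ Suc P * real (Suc M) ^ P"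
        unfolding power_add[symmetric] by (rule arg_cong[of _ _ "(^) _"]) simp
      then show ?thesis by (simp only: of_nat_mult of_nat_power of_nat_numeral mult_ac)
    qed
    finally show ?thesis .
  qed
  then have "real (card (codes k M P)) \<le> (\<Sum>p\<le>P. real (Suc M) ^ (3 * P + 1) * 2 ^ P * ?g)"
    unfolding card_codes of_nat_sum by (intro sum_mono) auto
  also have "\<dots> = real (Suc P) * (real (Suc M) ^ (3 * P + 1) * 2 ^ P * ?g)" by simp
  also have "\<dots> \<le> real (Suc M) * (real (Suc M) ^ (3 * P + 1) * 2 ^ P * ?g)"
    using P G by (intro mult_right_mono) auto
  also have "\<dots> = real (Suc M) ^ (3 * P + 2) * 2 ^ P * ?g" by (simp add: mult_ac)
  finally show ?thesis .
qed

lemma quotient_card_le: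
  assumes eq: "equiv UNIV rel" and fin: "finite C"
    and ex: "\<And>w. w \<in> A \<Longrightarrow> \<exists>x\<in>C. Q w x"
    and det: "\<And>w w' x. w \<in> A \<Longrightarrow> w' \<in> A \<Longrightarrow> Q w x \<Longrightarrow> Q w' x \<Longrightarrow> (w, w') \<in> rel"
  shows "finite (A // rel) \<and> card (A // rel) \<le> card C"
proof -
  define g where "g x = rel `` {SOME w. w \<in> A \<and> Q w x}" for x
  have sub: "A // rel \<subseteq> g ` C"
  proof
    fix X assume "X \<in> A // rel"
    then obtain w where w: "w \<in> A" "X = rel `` {w}" by (auto simp: quotient_def)
    obtain x where x: "x \<in> C" "Q w x" using ex[OF w(1)] by auto
    define w' where "w' = (SOME w. w \<in> A \<and> Q w x)"
    have "w \<in> A \<and> Q w x" using w(1) x(2) ..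
    then have w': "w' \<in> A \<and> Q w' x" unfolding w'_def by (rule someI)
    have "(w, w') \<in> rel" by (rule det[OF w(1) _ x(2)]) (use w' in simp_all)
    then have "rel `` {w} = rel `` {w'}" by (rule equiv_class_eq[OF eq])
    then have "X = g x" by (simp add: g_def w'_def w(2))
    then show "X \<in> g ` C" using x(1) by (rule image_eqI)
  qed
  have "card (A // rel) \<le> card (g ` C)" using fin by (intro card_mono sub) simp
  also have "\<dots> \<le> card C" by (rule card_image_le[OF fin])
  finally show ?thesis using finite_subset[OF sub] fin by simp
qed

definition letters_of :: "nat \<Rightarrow> nat \<Rightarrow> nat list \<Rightarrow> letters" where
  "letters_of k m w = zip (sign_pattern k m) (tl w)"

definition encodes :: "nat \<Rightarrow> nat \<Rightarrow> nat list \<Rightarrow> walk_code \<Rightarrow> bool" where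
  "encodes k m w = (\<lambda>(p, x, \<beta>, d). \<exists>R. peel (hd w) [] (letters_of k m w) = (d, R) \<and>
     described_by (length R) ((!) (verts (hd w) R)) p (fst x) (fst (snd x)) (snd (snd x)) \<beta> \<and>
     map fst R = core_signs p x \<beta>)"

lemma admissible_word:
  assumes k: "k \<ge> 1" and m: "m \<ge> 1" and w: "admissible k m w"
  shows "verts (hd w) (letters_of k m w) = w"
    and "map fst (letters_of k m w) = sign_interval k 0 (2 * k * m)"
    and "closed_walk (hd w) (letters_of k m w)"
    and "edges_repeated (hd w) (letters_of k m w)"
    and "num_vertices k m w = card (set w)"
    and "num_edges k m w \<le> k * m"
proof -
  define M where "M = 2 * (k * m)"
  define X where "X = letters_of k m w"
  have M0: "M > 0" using k m by (simp add: M_def)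
  have len: "length w = Suc M" and cl: "w ! M = w ! 0"
    using w by (auto simp: admissible_def closed_word_def M_def)
  have lp: "length (sign_pattern k m) = M"
    unfolding sign_pattern_eq_interval[OF k] by (simp add: M_def)
  have w_ne: "w \<noteq> []" using len by auto
  have lX: "length X = M" using len lp by (simp add: X_def letters_of_def)
  show v: "verts (hd w) (letters_of k m w) = w"
    using w_ne len lp by (simp add: verts_def letters_of_def)
  show "map fst (letters_of k m w) = sign_interval k 0 (2 * k * m)"
    using len lp by (simp add: letters_of_def flip: sign_pattern_eq_interval[OF k])
  show "closed_walk (hd w) (letters_of k m w)"
    unfolding closed_walk_def v using cl w_ne len by (simp add: last_conv_nth hd_conv_nth)
  have var: "walk_edges (hd w) X ! i = var_edge k m w (Suc i)" if "i < M" for i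
    using nth_walk_edges[of i X "hd w"] that lX len lp v
    by (simp add: var_edge_def plus_occurrence_def X_def letters_of_def)
  have occ: "occurrences k m = Suc ` {..<M}"
    unfolding occurrences_def M_def[symmetric] by (simp add: image_Suc_lessThan)
  have vars_set: "set (walk_edges (hd w) X) = var_edge k m w ` occurrences k m"
  proof -
    have "set (walk_edges (hd w) X) = (\<lambda>i. walk_edges (hd w) X ! i) ` {..<M}"
      by (auto simp: set_conv_nth lX)
    also have "\<dots> = (\<lambda>i. var_edge k m w (Suc i)) ` {..<M}" using var by (intro image_cong) auto
    finally show ?thesis by (simp add: occ image_image)
  qed
  have cnt: "count_list (walk_edges (hd w) X) e = card {s \<in> occurrences k m. var_edge k m w s = e}" for e
  proof -
    have "{s \<in> occurrences k m. var_edge k m w s = e} = Suc ` {i. i < M \<and> walk_edges (hd w) X ! i = e}"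
      unfolding occ using var by auto
    then show ?thesis by (simp add: count_list_card lX card_image)
  qed
  have two: "count_list (walk_edges (hd w) X) e \<ge> 2" if "e \<in> set (walk_edges (hd w) X)" for e
    using w that unfolding admissible_def vars_set cnt by blast
  then show "edges_repeated (hd w) (letters_of k m w)" by (simp add: edges_repeated_def X_def)
  have "(\<lambda>j. w ! j) ` {..<M} = set w"
  proof -
    have "set w = (\<lambda>j. w ! j) ` {..<Suc M}" using len by (auto simp: set_conv_nth)
    also have "\<dots> = insert (w ! M) ((\<lambda>j. w ! j) ` {..<M})" by (simp add: lessThan_Suc)
    also have "\<dots> = (\<lambda>j. w ! j) ` {..<M}" using cl M0 by (intro insert_absorb) auto
    finally show ?thesis ..
  qed
  then show "num_vertices k m w = card (set w)" by (simp add: num_vertices_def M_def)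
  have "2 * card (set (walk_edges (hd w) X)) = (\<Sum>e\<in>set (walk_edges (hd w) X). 2)" by simp
  also have "\<dots> \<le> (\<Sum>e\<in>set (walk_edges (hd w) X). count_list (walk_edges (hd w) X) e)"
    using two by (intro sum_mono) auto
  also have "\<dots> = M" by (simp add: sum_count_set lX)
  finally show "num_edges k m w \<le> k * m" by (simp add: num_edges_def vars_set[symmetric] M_def)
qed

lemma encodes_exists:
  assumes k: "k \<ge> 1" and m: "m \<ge> 1" and w: "admissible k m w" "defect k m w = int r"
  shows "\<exists>x\<in>codes k (2 * k * m) (min (8 * r) (2 * k * m)). encodes k m w x"
proof -
  define X where "X = letters_of k m w"
  define b where "b = hd w"
  obtain d R where peel: "peel b [] X = (d, R)" by force
  note W = admissible_word[OF k m w(1), folded X_def b_def]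
  have X: "map fst X = sign_interval k 0 (2 * k * m)" by (rule W(2))
  have lX: "length X = 2 * k * m" using arg_cong[OF X, of length] by simp
  have C: "edges_repeated b R" "closed_walk b R" "d \<in> reductions (sign_interval k 0 (2 * k * m)) (map fst R)"
    "\<forall>l\<in>set R. snd l = b \<or> count_list (map snd R) (snd l) \<ge> 2"
    "2 * card (set (verts b R)) + 2 * k * m = 2 * card (set w) + length R"
    using peel_correct[OF peel] W(1,3,4) by (auto simp: X lX)
  have "int (k * m) + 1 - int (card (set w)) \<le> int r"
    using w(2) W(5,6) unfolding defect_def by linarith
  then have "length R + 2 \<le> 2 * card (set (verts b R)) + 2 * r" using C(5) by linarith
  from reduced_walk_shape[OF C(1,2,4) this] obtain p c dir lab \<beta> where
    p: "p \<le> 8 * r" "p \<le> length R" "(c, dir, lab) \<in> shapes p"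
    and \<beta>: "\<beta> \<in> PiE (c ` {..<p}) (\<lambda>_. segment_words (length R))"
    and D: "described_by (length R) ((!) (verts b R)) p c dir lab \<beta>"
    and S: "map fst R = concat (map (\<lambda>j. orient (dir j) (\<beta> (c j))) [0..<p])" by blast
  have "card (reductions (sign_interval k 0 (2 * k * m)) (map fst R)) \<noteq> 0"
    using C(3) finite_reductions card_0_eq by blast
  then have "length R \<le> 2 * k * m"
    using red_count_eq_0[of "sign_interval k 0 (2 * k * m)" "map fst R"] by (fastforce simp: card_reductions)
  then have "segment_words (length R) \<subseteq> segment_words (2 * k * m)"
    by (auto simp: segment_words_def words_upto_def)
  then have "\<beta> \<in> PiE (c ` {..<p}) (\<lambda>_. segment_words (2 * k * m))"
    using \<beta> PiE_mono[of "c ` {..<p}" "\<lambda>_. segment_words (length R)" "\<lambda>_. segment_words (2 * k * m)"]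
    by blast
  moreover have S': "map fst R = core_signs p (c, dir, lab) \<beta>" using S by (simp add: core_signs_def)
  ultimately have "(p, (c, dir, lab), \<beta>, d) \<in> codes k (2 * k * m) (min (8 * r) (2 * k * m))"
    using p C(3) \<open>length R \<le> 2 * k * m\<close> by (simp add: codes_def)
  moreover have "encodes k m w (p, (c, dir, lab), \<beta>, d)"
    using peel D S' by (simp add: encodes_def X_def b_def)
  ultimately show ?thesis by blast
qed

lemma encodes_determines:
  assumes k: "k \<ge> 1" and m: "m \<ge> 1" and w: "admissible k m w" "admissible k m w'"
    and x: "encodes k m w x" "encodes k m w' x"
  shows "(w, w') \<in> relabel_rel"
proof -
  obtain p s \<beta> d where xx: "x = (p, s, \<beta>, d)" by (cases x) auto
  obtain R where R: "peel (hd w) [] (letters_of k m w) = (d, R)"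
    "described_by (length R) ((!) (verts (hd w) R)) p (fst s) (fst (snd s)) (snd (snd s)) \<beta>"
    "map fst R = core_signs p s \<beta>"
    using x(1) by (auto simp: encodes_def xx)
  obtain R' where R': "peel (hd w') [] (letters_of k m w') = (d, R')"
    "described_by (length R') ((!) (verts (hd w') R')) p (fst s) (fst (snd s)) (snd (snd s)) \<beta>"
    "map fst R' = core_signs p s \<beta>"
    using x(2) by (auto simp: encodes_def xx)
  have len: "length R' = length R" using arg_cong[OF R(3), of length] arg_cong[OF R'(3), of length] by simp
  have "(verts (hd w) R, verts (hd w') R') \<in> relabel_rel"
  proof (rule relabel_relI)
    show "length (verts (hd w) R) = length (verts (hd w') R')" by (simp add: verts_def len)
    fix i j assume "i < length (verts (hd w) R)" "j < length (verts (hd w) R)"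
    then have ij: "i \<le> length R" "j \<le> length R" by (auto simp: verts_def)
    show "verts (hd w) R ! i = verts (hd w) R ! j \<longleftrightarrow> verts (hd w') R' ! i = verts (hd w') R' ! j"
      using described_by_same_partition[OF R(2) R'(2)[unfolded len] ij]
        described_by_same_partition[OF R'(2)[unfolded len] R(2) ij] by blast
  qed
  then have "(verts (hd w) ([] @ letters_of k m w), verts (hd w') ([] @ letters_of k m w')) \<in> relabel_rel"
    using admissible_word(3,4)[OF k m w(1)] admissible_word(3,4)[OF k m w(2)]
    by (intro peel_determines[OF R(1) _ _ R'(1)]) auto
  then show ?thesis
    using admissible_word(1)[OF k m w(1)] admissible_word(1)[OF k m w(2)] by simp
qed

lemma card_admissible_classes_le:
  assumes k: "k \<ge> 1" and m: "m \<ge> 1"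
  shows "finite (admissible_classes k m r) \<and>
    card (admissible_classes k m r) \<le> card (codes k (2 * k * m) (min (8 * r) (2 * k * m)))"
  unfolding admissible_classes_def
  by (rule quotient_card_le[OF equiv_relabel_rel finite_codes, where Q = "encodes k m"])
     (use encodes_exists[OF k m] encodes_determines[OF k m] in auto)

text \<open>
  All factors apart from \<open>growth k ^ m\<close> are powers, with exponent \<open>O(r)\<close>, of quantities that are at most \<open>(3 k + 2 growth k) m\<close>; replacing
  \<open>growth k ^ m\<close> by the Fuss-Catalan number costs two more of them. The exponent is \<open>4 P + 5 \<le> 32 r + 5 \<le> 37 r\<close>.
\<close>

lemma code_bound:
  assumes k: "k \<ge> 1" and m: "m \<ge> 1" and r: "r \<ge> 1" and P: "P \<le> 8 * r" "P \<le> 2 * k * m"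
  shows "real (card (codes k (2 * k * m) P)) \<le>
    fuss_catalan k m * ((3 * real k + 2 * growth k) * real m) ^ (37 * r)"
proof -
  define M where "M = 2 * k * m"
  \<comment> \<open>\<open>Z\<close> dominates both the number of positions and \<open>2 growth k\<close>.\<close>
  define Z where "Z = (3 * real k + 2 * growth k) * real m"
  have G: "growth k \<ge> 1" by (rule growth_ge_1[OF k])
  have F0: "fuss_catalan k m \<ge> 0" by (simp add: fuss_catalan_def)
  have km: "real k * real m \<ge> 1"
    using k m mult_mono[of 1 "real k" 1 "real m"] by simp
  have M1: "real (Suc M) \<le> 3 * real k * real m" using km by (simp add: M_def)
  have ZM: "real (Suc M) \<le> Z"
  proof -
    have "0 \<le> 2 * growth k * real m" using G by simp
    then show ?thesis using M1 unfolding Z_def distrib_right by linarith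
  qed
  have ZG: "2 * growth k \<le> Z"
  proof -
    have "2 * growth k * 1 \<le> (3 * real k + 2 * growth k) * real m"
      using m G by (intro mult_mono) auto
    then show ?thesis by (simp add: Z_def)
  qed
  have Z1: "Z \<ge> 1" using ZG G by simp
  have Mdiv: "M div (2 * k) = m" using k by (simp add: M_def)
  have grow: "growth k ^ m \<le> real (Suc M) ^ 2 * fuss_catalan k m"
  proof -
    have "growth k ^ m \<le> real (k * m + 1) * real (Suc k * m + 1) * fuss_catalan k m"
      by (rule growth_le_fuss_catalan[OF k])
    also have "\<dots> \<le> (real (Suc M) * real (Suc M)) * fuss_catalan k m"
    proof (intro mult_right_mono mult_mono F0)
      have "m \<le> k * m" using k by simp
      then show "real (k * m + 1) \<le> real (Suc M)" "real (Suc k * m + 1) \<le> real (Suc M)"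
        unfolding of_nat_le_iff M_def by (simp_all add: mult.assoc)
    qed auto
    finally show ?thesis by (simp add: power2_eq_square)
  qed
  have "real (card (codes k M P)) \<le> real (Suc M) ^ (3 * P + 2) * 2 ^ P * growth k ^ (M div (2 * k) + P + 1)"
    using P by (intro card_codes_le[OF k]) (simp add: M_def)
  also have "\<dots> = real (Suc M) ^ (3 * P + 2) * (2 ^ P * growth k ^ (P + 1)) * growth k ^ m"
    unfolding Mdiv power_add by (simp only: mult_ac)
  also have "\<dots> \<le> Z ^ (3 * P + 2) * Z ^ (P + 1) * (Z ^ 2 * fuss_catalan k m)"
  proof (intro mult_mono)
    show "real (Suc M) ^ (3 * P + 2) \<le> Z ^ (3 * P + 2)" using ZM by (intro power_mono) auto
    have "2 ^ P * growth k ^ (P + 1) \<le> 2 ^ (P + 1) * growth k ^ (P + 1)"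
      using G by (intro mult_right_mono power_increasing) auto
    also have "\<dots> = (2 * growth k) ^ (P + 1)" by (rule power_mult_distrib[symmetric])
    also have "\<dots> \<le> Z ^ (P + 1)" using ZG G by (intro power_mono) auto
    finally show "2 ^ P * growth k ^ (P + 1) \<le> Z ^ (P + 1)" .
    have "real (Suc M) ^ 2 * fuss_catalan k m \<le> Z ^ 2 * fuss_catalan k m"
      using ZM F0 by (intro mult_right_mono power_mono) auto
    then show "growth k ^ m \<le> Z ^ 2 * fuss_catalan k m" using grow by simp
  qed (use G Z1 F0 in auto)
  also have "\<dots> = fuss_catalan k m * Z ^ (4 * P + 5)"
  proof -
    have "Z ^ (4 * P + 5) = Z ^ (3 * P + 2) * Z ^ (P + 1) * Z ^ 2"
      unfolding power_add[symmetric] by (rule arg_cong[of _ _ "(^) _"]) simp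
    then show ?thesis by (simp only: mult_ac)
  qed
  also have "\<dots> \<le> fuss_catalan k m * Z ^ (37 * r)"
    using P r Z1 F0 by (intro mult_left_mono power_increasing) auto
  finally show ?thesis by (simp add: M_def Z_def)
qed

theorem proposition3p7:
  fixes k :: nat
  assumes "k \<ge> 1"
  shows "\<exists>C D :: real. C > 0 \<and> D > 0 \<and>
    (\<forall>m::nat. m \<ge> 1 \<longrightarrow> (\<forall>r::nat.
       finite (admissible_classes k m r) \<and>
       real (card (admissible_classes k m r)) \<le> fuss_catalan k m * (C * real m) powr (D * real r)))"
proof (intro exI conjI allI impI)
  let ?C = "3 * real k + 2 * growth k"
  have G: "growth k \<ge> 1" by (rule growth_ge_1[OF assms])
  show C0: "?C > 0" using G by linarith
  show "(37 :: real) > 0" by simp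
  fix m r :: nat
  assume m: "m \<ge> 1"
  note classes = card_admissible_classes_le[OF assms m, of r]
  show "finite (admissible_classes k m r)" using classes ..
  have pos: "?C * real m > 0" using C0 m by simp
  show "real (card (admissible_classes k m r)) \<le> fuss_catalan k m * (?C * real m) powr (37 * real r)"
  proof (cases "r = 0")
    case True
    have "card (admissible_classes k m r) \<le> nc_count k 0 (2 * k * m)"
      using classes card_codes_0[of k "2 * k * m"] by (simp add: True nc_count_def)
    then have "real (card (admissible_classes k m r)) \<le> fuss_catalan k m"
      unfolding nc_count_eq_fuss_catalan[OF assms, symmetric] by simp
    moreover have "x powr 0 = 1" if "x > 0" for x :: real using that by simp
    from this[OF pos] have "(?C * real m) powr (37 * real r) = 1"
      by (simp only: True of_nat_0 mult_zero_right)
    ultimately show ?thesis by simp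
  next
    case False
    have "real (card (admissible_classes k m r)) \<le> real (card (codes k (2 * k * m) (min (8 * r) (2 * k * m))))"
      using classes by simp
    also have "\<dots> \<le> fuss_catalan k m * (?C * real m) ^ (37 * r)"
      using False by (intro code_bound[OF assms m]) auto
    also have "(?C * real m) ^ (37 * r) = (?C * real m) powr (37 * real r)"
      using powr_realpow[OF pos, of "37 * r"] by simp
    finally show ?thesis .
  qed
qed

end
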